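(* Let $\acute N$ be a radical screen transversal lightlike submanifold of a golden semi-Riemannian manifold $(\breve N,\breve g,\breve P)$. Then the radical distribution $\mathrm{Rad}\,T\acute N$ defines a totally geodesic foliation on $\acute N$ if and only if, for all $W,U\in\Gamma(\mathrm{Rad}\,T\acute N)$, $A_{\breve PU}W$ has no component in $S(T\acute N)$ and $A^*_UW=0$.
   Context: Golden semi-Riemannian manifold: a semi-Riemannian manifold $(\breve N,\breve g)$ with a $(1,1)$-tensor field $\breve P$ such that $\breve P^2=\breve P+I$ and $\breve g(\breve PW,U)=\breve g(W,\breve PU)$ for all vector fields $W,U$; moreover $\breve\nabla_W\breve PU=\breve P\breve\nabla_WU$, where $\breve\nabla$ is the Levi-Civita connection of $\breve g$. Lightlike submanifold: $\acute N$ is an immersed submanifold whose induced metric $g$ is degenerate, with $\mathrm{Rad}\,T\acute N=T\acute N\cap T\acute N^\perp$ a distribution of constant rank $r\ge1$. Fix a screen distribution $S(T\acute N)$ (a semi-Riemannian, i.e. nondegenerate, complement of $\mathrm{Rad}\,T\acute N$ in $T\acute N$), a screen transversal bundle $S(T\acute N^\perp)$ (a nondegenerate complement of $\mathrm{Rad}\,T\acute N$ in $T\acute N^\perp$), and the associated lightlike transversal bundle $\mathrm{ltr}(T\acute N)$, locally spanned by null sections $N_i$ orthogonal to $S(T\acute N)$, to $S(T\acute N^\perp)$ and to each other, with $\breve g(N_i,\xi_j)=\delta_{ij}$ for a local basis $\{\xi_j\}$ of $\mathrm{Rad}\,T\acute N$. Thus $T\breve N|_{\acute N}=S(T\acute N)\perp[\mathrm{Rad}\,T\acute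 N\oplus \mathrm{ltr}(T\acute N)]\perp S(T\acute N^\perp)$. Gauss–Weingarten formulas, for $W,U\in\Gamma(T\acute N)$, $Z\in\Gamma(S(T\acute N^\perp))$ and $\xi\in\Gamma(\mathrm{Rad}\,T\acute N)$: $\breve\nabla_WU=\nabla_WU+h^\ell(W,U)+h^s(W,U)$, $\breve\nabla_WZ=-A_ZW+\nabla^s_WZ+D^\ell(W,Z)$, and $\nabla_W\xi=-A^*_\xi W+\nabla^{*t}_W\xi$, where $\nabla_WU,A_ZW\in\Gamma(T\acute N)$ ($\nabla$ is the induced connection); $h^\ell(W,U),D^\ell(W,Z)\in\Gamma(\mathrm{ltr}(T\acute N))$; $h^s(W,U),\nabla^s_WZ\in\Gamma(S(T\acute N^\perp))$; $A^*_\xi W\in\Gamma(S(T\acute N))$ and $\nabla^{*t}_W\xi\in\Gamma(\mathrm{Rad}\,T\acute N)$. The component of a section of $T\acute N$ in $S(T\acute N)$ is taken with respect to $T\acute N=\mathrm{Rad}\,T\acute N\perp S(T\acute N)$. $\acute N$ is a screen transversal lightlike submanifold if $\breve P\,\mathrm{Rad}\,T\acute N\subset S(T\acute N^\perp)$. It is radical screen transversal if in addition $\breve P(S(T\acute N))=S(T\acute N)$. $\mathrm{Rad}\,T\acute N$ defines a totally geodesic foliation on $\acute N$ if $\nabla_WU\in\Gamma(\mathrm{Rad}\,T\acute N)$ for all $W,U\in\Gamma(\mathrm{Rad}\,T\acute N)$, i.e. $\breve g(\nabla_WU,Z)=0$ for all such $W,U$ and all $Z\in\Gamma(S(T\acute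 N))$. *)

theory Defs
  imports "HOL-Analysis.Analysis" "HOL-Library.Function_Algebras"
begin

section \<open>Smooth manifolds\<close>

text \<open>The predicate \<open>Ck_on k f S\<close> is only used for open \<open>S\<close>.\<close>

primrec Ck_on ::
  "nat \<Rightarrow> ('e::euclidean_space \<Rightarrow> 'f::real_normed_vector) \<Rightarrow> 'e set \<Rightarrow> bool" where
  "Ck_on 0 f S \<longleftrightarrow> continuous_on S f"
| "Ck_on (Suc k) f S \<longleftrightarrow> (\<forall>x\<in>S. f differentiable (at x)) \<and>
     (\<forall>v. Ck_on k (\<lambda>x. frechet_derivative f (at x) v) S)"

definition smooth_on ::
  "'e::euclidean_space set \<Rightarrow> ('e \<Rightarrow> 'f::real_normed_vector) \<Rightarrow> bool" where
  "smooth_on S f \<longleftrightarrow> (\<forall>k. Ck_on k f S)"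

text \<open>A chart is a pair of its domain and the coordinate map. The manifold is a whole type
  carrying its topology; it is modelled on \<open>'e\<close>, so its dimension is \<open>DIM('e)\<close>. The atlas need
  not be maximal.\<close>

type_synonym ('m, 'e) atlas = "('m set \<times> ('m \<Rightarrow> 'e)) set"

definition smooth_manifold ::
  "('m::{t2_space, second_countable_topology}, 'e::euclidean_space) atlas \<Rightarrow> bool" where
  "smooth_manifold A \<longleftrightarrow>
     (\<forall>(D, \<phi>)\<in>A. open D \<and> open (\<phi> ` D) \<and> homeomorphism D (\<phi> ` D) \<phi> (inv_into D \<phi>)) \<and>
     (\<Union>(D, \<phi>)\<in>A. D) = UNIV \<and>
     (\<forall>(D, \<phi>)\<in>A. \<forall>(D', \<psi>)\<in>A. smooth_on (\<phi> ` (D \<inter> D')) (\<psi> \<circ> inv_into D \<phi>))"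

definition smooth_fun_on ::
  "('m, 'e::euclidean_space) atlas \<Rightarrow> 'm set \<Rightarrow> ('m \<Rightarrow> real) \<Rightarrow> bool" where
  "smooth_fun_on A Q a \<longleftrightarrow> (\<forall>(D, \<phi>)\<in>A. smooth_on (\<phi> ` (D \<inter> Q)) (a \<circ> inv_into D \<phi>))"

definition smooth_funs :: "('m, 'e::euclidean_space) atlas \<Rightarrow> ('m \<Rightarrow> real) set" where
  "smooth_funs A = {a. smooth_fun_on A UNIV a}"

definition smooth_map ::
  "('n::topological_space, 'd::euclidean_space) atlas \<Rightarrow>
   ('m::topological_space, 'e::euclidean_space) atlas \<Rightarrow> ('n \<Rightarrow> 'm) \<Rightarrow> bool" where
  "smooth_map A B f \<longleftrightarrow> continuous_on UNIV f \<and>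
     (\<forall>(D, \<phi>)\<in>A. \<forall>(D', \<psi>)\<in>B.
        smooth_on (\<phi> ` (D \<inter> f -` D')) (\<psi> \<circ> f \<circ> inv_into D \<phi>))"


section \<open>Tangent vectors and vector fields\<close>

text \<open>Tangent vectors at \<open>p\<close> are the derivations at \<open>p\<close> of the algebra of smooth functions,
  extended by 0 to the functions that are not smooth so that each derivation has a unique
  representative. Sums, differences and zero of tangent vectors are the pointwise ones of
  \<open>Function_Algebras\<close>, which also gives the operations on real functions and on fields.\<close>

type_synonym 'm tvec = "('m \<Rightarrow> real) \<Rightarrow> real"

definition tscale :: "real \<Rightarrow> 'm tvec \<Rightarrow> 'm tvec" (infixr "*\<^sub>t" 75) where
  "c *\<^sub>t v = (\<lambda>a. c * v a)"

definition tangent_space :: "('m, 'e::euclidean_space) atlas \<Rightarrow> 'm \<Rightarrow> 'm tvec set" where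
  "tangent_space A p = {v.
     (\<forall>a. a \<notin> smooth_funs A \<longrightarrow> v a = 0) \<and>
     (\<forall>a\<in>smooth_funs A. \<forall>c. v (\<lambda>x. c * a x) = c * v a) \<and>
     (\<forall>a\<in>smooth_funs A. \<forall>b\<in>smooth_funs A.
        v (a + b) = v a + v b \<and> v (a * b) = v a * b p + a p * v b)}"

definition push ::
  "('m, 'e::euclidean_space) atlas \<Rightarrow> ('n \<Rightarrow> 'm) \<Rightarrow> 'n tvec \<Rightarrow> 'm tvec" where
  "push B f v = (\<lambda>a. if a \<in> smooth_funs B then v (a \<circ> f) else 0)"

text \<open>Smooth vector fields along \<open>f\<close> over the open set \<open>Q\<close>, that is, sections over \<open>Q\<close> of the
  pullback under \<open>f\<close> of the tangent bundle. For the identity map these are the vector fields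
  on \<open>Q\<close>.\<close>

definition fields_along_on ::
  "('n, 'd::euclidean_space) atlas \<Rightarrow> ('m, 'e::euclidean_space) atlas \<Rightarrow> ('n \<Rightarrow> 'm) \<Rightarrow>
   'n set \<Rightarrow> ('n \<Rightarrow> 'm tvec) set" where
  "fields_along_on A B f Q = {V. (\<forall>p\<in>Q. V p \<in> tangent_space B (f p)) \<and>
     (\<forall>a\<in>smooth_funs B. smooth_fun_on A Q (\<lambda>p. V p a))}"

abbreviation "fields_along A B f \<equiv> fields_along_on A B f UNIV"

abbreviation "vector_fields A \<equiv> fields_along A A (\<lambda>p. p)"

definition lie_bracket ::
  "('m, 'e::euclidean_space) atlas \<Rightarrow> ('m \<Rightarrow> 'm tvec) \<Rightarrow> ('m \<Rightarrow> 'm tvec) \<Rightarrow> 'm \<Rightarrow> 'm tvec" where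
  "lie_bracket B X Y q =
     (\<lambda>a. if a \<in> smooth_funs B then X q (\<lambda>x. Y x a) - Y q (\<lambda>x. X x a) else 0)"

definition immersion ::
  "('n::topological_space, 'd::euclidean_space) atlas \<Rightarrow>
   ('m::topological_space, 'e::euclidean_space) atlas \<Rightarrow> ('n \<Rightarrow> 'm) \<Rightarrow> bool" where
  "immersion A B f \<longleftrightarrow> smooth_map A B f \<and> (\<forall>p. inj_on (push B f) (tangent_space A p))"


section \<open>Distributions\<close>

definition smooth_frame_on ::
  "('n, 'd::euclidean_space) atlas \<Rightarrow> ('m, 'e::euclidean_space) atlas \<Rightarrow> ('n \<Rightarrow> 'm) \<Rightarrow>
   'n set \<Rightarrow> ('n \<Rightarrow> 'm tvec set) \<Rightarrow> nat \<Rightarrow> (nat \<Rightarrow> 'n \<Rightarrow> 'm tvec) \<Rightarrow> bool" where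
  "smooth_frame_on A B f Q E k e \<longleftrightarrow>
     (\<forall>i<k. e i \<in> fields_along_on A B f Q) \<and>
     (\<forall>p\<in>Q. E p = range (\<lambda>c. \<Sum>i<k. c i *\<^sub>t e i p) \<and>
        (\<forall>c. (\<Sum>i<k. c i *\<^sub>t e i p) = 0 \<longrightarrow> (\<forall>i<k. c i = 0)))"

text \<open>A smooth subbundle of rank \<open>k\<close> of the pullback of the tangent bundle. For the identity
  map this is a distribution on the manifold itself.\<close>

definition smooth_subbundle ::
  "('n::topological_space, 'd::euclidean_space) atlas \<Rightarrow> ('m, 'e::euclidean_space) atlas \<Rightarrow>
   ('n \<Rightarrow> 'm) \<Rightarrow> ('n \<Rightarrow> 'm tvec set) \<Rightarrow> nat \<Rightarrow> bool" where
  "smooth_subbundle A B f E k \<longleftrightarrow>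
     (\<forall>p. \<exists>Q e. open Q \<and> p \<in> Q \<and> smooth_frame_on A B f Q E k e)"

abbreviation "smooth_distribution A E k \<equiv> smooth_subbundle A A (\<lambda>p. p) E k"

definition distr_sections ::
  "('n, 'd::euclidean_space) atlas \<Rightarrow> ('n \<Rightarrow> 'n tvec set) \<Rightarrow> ('n \<Rightarrow> 'n tvec) set" where
  "distr_sections A E = {X \<in> vector_fields A. \<forall>p. X p \<in> E p}"

definition direct_sum :: "'m tvec set \<Rightarrow> 'm tvec set \<Rightarrow> 'm tvec set \<Rightarrow> bool" where
  "direct_sum T E F \<longleftrightarrow> T = {u + v | u v. u \<in> E \<and> v \<in> F} \<and> E \<inter> F = {0}"

definition nondegenerate_on ::
  "('m tvec \<Rightarrow> 'm tvec \<Rightarrow> real) \<Rightarrow> 'm tvec set \<Rightarrow> bool" where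
  "nondegenerate_on b E \<longleftrightarrow> (\<forall>u\<in>E. (\<forall>v\<in>E. b u v = 0) \<longrightarrow> u = 0)"


section \<open>Semi-Riemannian metrics and connections\<close>

type_synonym 'm metric = "'m \<Rightarrow> 'm tvec \<Rightarrow> 'm tvec \<Rightarrow> real"

text \<open>The largest dimension of a subspace of \<open>E\<close> on which \<open>b\<close> is negative definite.
  The inequality for all nonzero coefficients already makes the \<open>e i\<close> linearly independent.\<close>

definition neg_index :: "('m tvec \<Rightarrow> 'm tvec \<Rightarrow> real) \<Rightarrow> 'm tvec set \<Rightarrow> nat" where
  "neg_index b E = (GREATEST k. \<exists>e. (\<forall>i<k. e i \<in> E) \<and>
     (\<forall>c. (\<exists>i<k. c i \<noteq> 0) \<longrightarrow> b (\<Sum>i<k. c i *\<^sub>t e i) (\<Sum>i<k. c i *\<^sub>t e i) < 0))"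

definition semi_riemannian_metric ::
  "('m, 'e::euclidean_space) atlas \<Rightarrow> 'm metric \<Rightarrow> bool" where
  "semi_riemannian_metric B g \<longleftrightarrow>
     (\<forall>q. \<forall>u\<in>tangent_space B q. \<forall>v\<in>tangent_space B q. \<forall>w\<in>tangent_space B q. \<forall>c.
        g q u v = g q v u \<and> g q (u + v) w = g q u w + g q v w \<and> g q (c *\<^sub>t u) v = c * g q u v) \<and>
     (\<forall>q. nondegenerate_on (g q) (tangent_space B q)) \<and>
     (\<forall>X\<in>vector_fields B. \<forall>Y\<in>vector_fields B. (\<lambda>q. g q (X q) (Y q)) \<in> smooth_funs B) \<and>
     (\<exists>\<nu>. \<forall>q. neg_index (g q) (tangent_space B q) = \<nu>)"

text \<open>A linear connection on the pullback under \<open>f\<close> of the tangent bundle; for the identity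
  map, an affine connection on the manifold.\<close>

definition connection_along ::
  "('n, 'd::euclidean_space) atlas \<Rightarrow> ('m, 'e::euclidean_space) atlas \<Rightarrow> ('n \<Rightarrow> 'm) \<Rightarrow>
   (('n \<Rightarrow> 'n tvec) \<Rightarrow> ('n \<Rightarrow> 'm tvec) \<Rightarrow> 'n \<Rightarrow> 'm tvec) \<Rightarrow> bool" where
  "connection_along A B f D \<longleftrightarrow>
     (\<forall>W\<in>vector_fields A. \<forall>W'\<in>vector_fields A.
      \<forall>V\<in>fields_along A B f. \<forall>V'\<in>fields_along A B f. \<forall>a\<in>smooth_funs A.
        D W V \<in> fields_along A B f \<and>
        D (W + W') V = D W V + D W' V \<and>
        D (\<lambda>p. a p *\<^sub>t W p) V = (\<lambda>p. a p *\<^sub>t D W V p) \<and>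
        D W (V + V') = D W V + D W V' \<and>
        D W (\<lambda>p. a p *\<^sub>t V p) = (\<lambda>p. W p a *\<^sub>t V p + a p *\<^sub>t D W V p))"

definition levi_civita ::
  "('m, 'e::euclidean_space) atlas \<Rightarrow> 'm metric \<Rightarrow>
   (('m \<Rightarrow> 'm tvec) \<Rightarrow> ('m \<Rightarrow> 'm tvec) \<Rightarrow> 'm \<Rightarrow> 'm tvec) \<Rightarrow> bool" where
  "levi_civita B g nab \<longleftrightarrow>
     connection_along B B (\<lambda>q. q) nab \<and>
     (\<forall>X\<in>vector_fields B. \<forall>Y\<in>vector_fields B. nab X Y - nab Y X = lie_bracket B X Y) \<and>
     (\<forall>X\<in>vector_fields B. \<forall>Y\<in>vector_fields B. \<forall>Z\<in>vector_fields B. \<forall>q.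
        X q (\<lambda>x. g x (Y x) (Z x)) = g q (nab X Y q) (Z q) + g q (Y q) (nab X Z q))"

text \<open>The connection induced by \<open>nab\<close> on vector fields along \<open>f\<close>: the unique one for which the
  derivative of the restriction of an ambient field \<open>Y\<close> is given by the ambient \<open>nab\<close>.
  It gives a meaning to the covariant derivative of fields that are only defined along the
  submanifold, in the direction of vector fields of the submanifold.\<close>

definition induced_connection_along ::
  "('n, 'd::euclidean_space) atlas \<Rightarrow> ('m, 'e::euclidean_space) atlas \<Rightarrow> ('n \<Rightarrow> 'm) \<Rightarrow>
   (('m \<Rightarrow> 'm tvec) \<Rightarrow> ('m \<Rightarrow> 'm tvec) \<Rightarrow> 'm \<Rightarrow> 'm tvec) \<Rightarrow>
   (('n \<Rightarrow> 'n tvec) \<Rightarrow> ('n \<Rightarrow> 'm tvec) \<Rightarrow> 'n \<Rightarrow> 'm tvec) \<Rightarrow> bool" where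
  "induced_connection_along A B f nab D \<longleftrightarrow>
     connection_along A B f D \<and>
     (\<forall>W\<in>vector_fields A. \<forall>X\<in>vector_fields B. \<forall>Y\<in>vector_fields B. \<forall>p.
        X (f p) = push B f (W p) \<longrightarrow> D W (\<lambda>x. Y (f x)) p = nab X Y (f p))"


section \<open>Golden semi-Riemannian manifolds\<close>

definition golden_semi_riemannian ::
  "('m::{t2_space, second_countable_topology}, 'e::euclidean_space) atlas \<Rightarrow> 'm metric \<Rightarrow>
   (('m \<Rightarrow> 'm tvec) \<Rightarrow> ('m \<Rightarrow> 'm tvec) \<Rightarrow> 'm \<Rightarrow> 'm tvec) \<Rightarrow>
   ('m \<Rightarrow> 'm tvec \<Rightarrow> 'm tvec) \<Rightarrow> bool" where
  "golden_semi_riemannian B g nab P \<longleftrightarrow>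
     smooth_manifold B \<and> semi_riemannian_metric B g \<and> levi_civita B g nab \<and>
     (\<forall>q. \<forall>u\<in>tangent_space B q. \<forall>v\<in>tangent_space B q. \<forall>c.
        P q u \<in> tangent_space B q \<and> P q (u + v) = P q u + P q v \<and> P q (c *\<^sub>t u) = c *\<^sub>t P q u) \<and>
     (\<forall>X\<in>vector_fields B. (\<lambda>q. P q (X q)) \<in> vector_fields B) \<and>
     (\<forall>q. \<forall>u\<in>tangent_space B q. P q (P q u) = P q u + u) \<and>
     (\<forall>q. \<forall>u\<in>tangent_space B q. \<forall>v\<in>tangent_space B q. g q (P q u) v = g q u (P q v)) \<and>
     (\<forall>W\<in>vector_fields B. \<forall>U\<in>vector_fields B.
        nab W (\<lambda>q. P q (U q)) = (\<lambda>q. P q (nab W U q)))"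


section \<open>Lightlike submanifolds\<close>

text \<open>The radical and the screen distribution consist of tangent vectors of the submanifold;
  the bundles in the normal and transversal directions consist of tangent vectors of the ambient
  manifold. The differential \<open>push B f\<close> identifies the former with ambient vectors.\<close>

definition normal_space ::
  "('n, 'd::euclidean_space) atlas \<Rightarrow> ('m, 'e::euclidean_space) atlas \<Rightarrow> ('n \<Rightarrow> 'm) \<Rightarrow>
   'm metric \<Rightarrow> 'n \<Rightarrow> 'm tvec set" where
  "normal_space A B f g p =
     {v \<in> tangent_space B (f p). \<forall>u\<in>tangent_space A p. g (f p) v (push B f u) = 0}"

definition Rad ::
  "('n, 'd::euclidean_space) atlas \<Rightarrow> ('m, 'e::euclidean_space) atlas \<Rightarrow> ('n \<Rightarrow> 'm) \<Rightarrow>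
   'm metric \<Rightarrow> 'n \<Rightarrow> 'n tvec set" where
  "Rad A B f g p = {w \<in> tangent_space A p. push B f w \<in> normal_space A B f g p}"

definition lightlike_submanifold ::
  "('n::{t2_space, second_countable_topology}, 'd::euclidean_space) atlas \<Rightarrow>
   ('m::{t2_space, second_countable_topology}, 'e::euclidean_space) atlas \<Rightarrow> ('n \<Rightarrow> 'm) \<Rightarrow>
   'm metric \<Rightarrow> nat \<Rightarrow> bool" where
  "lightlike_submanifold A B f g r \<longleftrightarrow>
     smooth_manifold A \<and> immersion A B f \<and> r \<ge> 1 \<and> smooth_distribution A (Rad A B f g) r"

definition screen_distribution ::
  "('n::topological_space, 'd::euclidean_space) atlas \<Rightarrow> ('m, 'e::euclidean_space) atlas \<Rightarrow>
   ('n \<Rightarrow> 'm) \<Rightarrow> 'm metric \<Rightarrow> ('n \<Rightarrow> 'n tvec set) \<Rightarrow> bool" where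
  "screen_distribution A B f g S \<longleftrightarrow>
     (\<exists>k. smooth_distribution A S k) \<and>
     (\<forall>p. direct_sum (tangent_space A p) (Rad A B f g p) (S p) \<and>
          nondegenerate_on (g (f p)) (push B f ` S p))"

definition screen_transversal_bundle ::
  "('n::topological_space, 'd::euclidean_space) atlas \<Rightarrow> ('m, 'e::euclidean_space) atlas \<Rightarrow>
   ('n \<Rightarrow> 'm) \<Rightarrow> 'm metric \<Rightarrow> ('n \<Rightarrow> 'm tvec set) \<Rightarrow> bool" where
  "screen_transversal_bundle A B f g St \<longleftrightarrow>
     (\<exists>k. smooth_subbundle A B f St k) \<and>
     (\<forall>p. direct_sum (normal_space A B f g p) (push B f ` Rad A B f g p) (St p) \<and>
          nondegenerate_on (g (f p)) (St p))"

definition lightlike_transversal_bundle ::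
  "('n::topological_space, 'd::euclidean_space) atlas \<Rightarrow> ('m, 'e::euclidean_space) atlas \<Rightarrow>
   ('n \<Rightarrow> 'm) \<Rightarrow> 'm metric \<Rightarrow> nat \<Rightarrow> ('n \<Rightarrow> 'n tvec set) \<Rightarrow> ('n \<Rightarrow> 'm tvec set) \<Rightarrow>
   ('n \<Rightarrow> 'm tvec set) \<Rightarrow> bool" where
  "lightlike_transversal_bundle A B f g r S St ltr \<longleftrightarrow>
     (\<forall>p. \<exists>Q \<xi> N. open Q \<and> p \<in> Q \<and>
        smooth_frame_on A A (\<lambda>x. x) Q (Rad A B f g) r \<xi> \<and>
        smooth_frame_on A B f Q ltr r N \<and>
        (\<forall>x\<in>Q. \<forall>i<r.
           (\<forall>j<r. g (f x) (N i x) (push B f (\<xi> j x)) = (if i = j then 1 else 0)) \<and>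
           (\<forall>j<r. g (f x) (N i x) (N j x) = 0) \<and>
           (\<forall>u\<in>S x. g (f x) (N i x) (push B f u) = 0) \<and>
           (\<forall>u\<in>St x. g (f x) (N i x) u = 0)))"


section \<open>The Gauss and Weingarten formulas\<close>

text \<open>The component in the tangent space of the submanifold with respect to its decomposition
  with complement \<open>ltr p\<close> plus \<open>St p\<close>, and the screen component of a tangent vector of the
  submanifold. Both decompositions exist and are unique for the bundles above.\<close>

definition tangential_part ::
  "('n, 'd::euclidean_space) atlas \<Rightarrow> ('m, 'e::euclidean_space) atlas \<Rightarrow> ('n \<Rightarrow> 'm) \<Rightarrow>
   ('n \<Rightarrow> 'm tvec set) \<Rightarrow> ('n \<Rightarrow> 'm tvec set) \<Rightarrow> 'n \<Rightarrow> 'm tvec \<Rightarrow> 'n tvec" where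
  "tangential_part A B f St ltr p v =
     (THE t. t \<in> tangent_space A p \<and> (\<exists>l\<in>ltr p. \<exists>s\<in>St p. v = push B f t + l + s))"

definition screen_part ::
  "('n, 'd::euclidean_space) atlas \<Rightarrow> ('m, 'e::euclidean_space) atlas \<Rightarrow> ('n \<Rightarrow> 'm) \<Rightarrow>
   'm metric \<Rightarrow> ('n \<Rightarrow> 'n tvec set) \<Rightarrow> 'n \<Rightarrow> 'n tvec \<Rightarrow> 'n tvec" where
  "screen_part A B f g S p t = (THE s. s \<in> S p \<and> (\<exists>w\<in>Rad A B f g p. t = w + s))"

text \<open>In the following, \<open>D\<close> is the connection along \<open>f\<close> induced by the ambient Levi-Civita
  connection: the induced connection \<open>\<nabla>\<^sub>W U\<close>, the shape operator \<open>A\<^sub>Z W\<close> for a section \<open>Z\<close> of the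
  screen transversal bundle, and the screen shape operator \<open>A\<^sup>*\<^sub>\<xi> W\<close> for a section \<open>\<xi>\<close> of the
  radical.\<close>

definition induced_conn ::
  "('n, 'd::euclidean_space) atlas \<Rightarrow> ('m, 'e::euclidean_space) atlas \<Rightarrow> ('n \<Rightarrow> 'm) \<Rightarrow>
   (('n \<Rightarrow> 'n tvec) \<Rightarrow> ('n \<Rightarrow> 'm tvec) \<Rightarrow> 'n \<Rightarrow> 'm tvec) \<Rightarrow>
   ('n \<Rightarrow> 'm tvec set) \<Rightarrow> ('n \<Rightarrow> 'm tvec set) \<Rightarrow>
   ('n \<Rightarrow> 'n tvec) \<Rightarrow> ('n \<Rightarrow> 'n tvec) \<Rightarrow> 'n \<Rightarrow> 'n tvec" where
  "induced_conn A B f D St ltr W U p =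
     tangential_part A B f St ltr p (D W (\<lambda>x. push B f (U x)) p)"

definition shape_op ::
  "('n, 'd::euclidean_space) atlas \<Rightarrow> ('m, 'e::euclidean_space) atlas \<Rightarrow> ('n \<Rightarrow> 'm) \<Rightarrow>
   (('n \<Rightarrow> 'n tvec) \<Rightarrow> ('n \<Rightarrow> 'm tvec) \<Rightarrow> 'n \<Rightarrow> 'm tvec) \<Rightarrow>
   ('n \<Rightarrow> 'm tvec set) \<Rightarrow> ('n \<Rightarrow> 'm tvec set) \<Rightarrow>
   ('n \<Rightarrow> 'm tvec) \<Rightarrow> ('n \<Rightarrow> 'n tvec) \<Rightarrow> 'n \<Rightarrow> 'n tvec" where
  "shape_op A B f D St ltr Z W p = - tangential_part A B f St ltr p (D W Z p)"

definition screen_shape_op ::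
  "('n, 'd::euclidean_space) atlas \<Rightarrow> ('m, 'e::euclidean_space) atlas \<Rightarrow> ('n \<Rightarrow> 'm) \<Rightarrow>
   'm metric \<Rightarrow> (('n \<Rightarrow> 'n tvec) \<Rightarrow> ('n \<Rightarrow> 'm tvec) \<Rightarrow> 'n \<Rightarrow> 'm tvec) \<Rightarrow>
   ('n \<Rightarrow> 'n tvec set) \<Rightarrow> ('n \<Rightarrow> 'm tvec set) \<Rightarrow> ('n \<Rightarrow> 'm tvec set) \<Rightarrow>
   ('n \<Rightarrow> 'n tvec) \<Rightarrow> ('n \<Rightarrow> 'n tvec) \<Rightarrow> 'n \<Rightarrow> 'n tvec" where
  "screen_shape_op A B f g D S St ltr \<xi> W p =
     - screen_part A B f g S p (induced_conn A B f D St ltr W \<xi> p)"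


section \<open>Radical screen transversal submanifolds and totally geodesic foliations\<close>

definition screen_transversal ::
  "('n, 'd::euclidean_space) atlas \<Rightarrow> ('m, 'e::euclidean_space) atlas \<Rightarrow> ('n \<Rightarrow> 'm) \<Rightarrow>
   'm metric \<Rightarrow> ('m \<Rightarrow> 'm tvec \<Rightarrow> 'm tvec) \<Rightarrow> ('n \<Rightarrow> 'm tvec set) \<Rightarrow> bool" where
  "screen_transversal A B f g P St \<longleftrightarrow> (\<forall>p. P (f p) ` push B f ` Rad A B f g p \<subseteq> St p)"

definition radical_screen_transversal ::
  "('n, 'd::euclidean_space) atlas \<Rightarrow> ('m, 'e::euclidean_space) atlas \<Rightarrow> ('n \<Rightarrow> 'm) \<Rightarrow>
   'm metric \<Rightarrow> ('m \<Rightarrow> 'm tvec \<Rightarrow> 'm tvec) \<Rightarrow> ('n \<Rightarrow> 'n tvec set) \<Rightarrow> ('n \<Rightarrow> 'm tvec set) \<Rightarrow>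
   bool" where
  "radical_screen_transversal A B f g P S St \<longleftrightarrow>
     screen_transversal A B f g P St \<and> (\<forall>p. P (f p) ` push B f ` S p = push B f ` S p)"

text \<open>The connection \<open>nab\<close> is given on the submanifold by its values on vector fields; membership
  of \<open>nab W U\<close> in the sections of \<open>E\<close> is membership of its values in \<open>E\<close>, as \<open>nab W U\<close> is a
  smooth vector field.\<close>

definition totally_geodesic_foliation ::
  "('n, 'd::euclidean_space) atlas \<Rightarrow>
   (('n \<Rightarrow> 'n tvec) \<Rightarrow> ('n \<Rightarrow> 'n tvec) \<Rightarrow> 'n \<Rightarrow> 'n tvec) \<Rightarrow> ('n \<Rightarrow> 'n tvec set) \<Rightarrow> bool" where
  "totally_geodesic_foliation A nab E \<longleftrightarrow>
     (\<forall>W\<in>distr_sections A E. \<forall>U\<in>distr_sections A E. \<forall>p. nab W U p \<in> E p)"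

end

theory Submission
  imports Defs
begin

text \<open>
  The proof compares the covariant derivative \<open>v = D W U\<close> of a radical field \<open>U\<close> with that of
  \<open>P U\<close>. Pairing with a screen vector \<open>Z\<close> sees only the tangential part of an ambient vector: the
  lightlike transversal and the screen transversal bundles are both orthogonal to the screen. So
  the tangential part of \<open>v\<close> is radical if and only if \<open>g(v, Z) = 0\<close> for all \<open>Z\<close> in the
  screen (\<open>tangential_part_Rad_iff\<close>). That is the totally geodesic condition, and it is literally
  the vanishing of \<open>A\<^sup>*\<^sub>U W\<close>, the screen component of the tangential part of \<open>v\<close>.

  As \<open>P\<close> is parallel, \<open>D W (P U) = P v\<close>, and as \<open>P\<close> is self-adjoint,
  \<open>g(P v, Z) = g(v, P Z)\<close>. Since \<open>P\<close> maps the screen onto itself, \<open>P v\<close> is orthogonal to the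
  screen if and only if \<open>v\<close> is, which says that \<open>A\<^sub>P\<^sub>U W\<close> has no screen component if and only
  if the tangential part of \<open>v\<close> is radical. Thus each of the two conditions on the shape operators
  is by itself equivalent to the foliation being totally geodesic.

  Two facts need work. The first is linear algebra: the tangent space of the ambient manifold is
  the direct sum of the tangent space of the submanifold and the two transversal bundles
  (\<open>ambient_decomposition\<close>), so that the tangential part is well defined. One subtracts from a
  vector its projections to the screen and to the screen transversal space and its components
  along a null frame; what is left is normal to the submanifold and orthogonal to everything in
  the normal space and to the null frame, hence zero.

  The second is \<open>D W (P V) = P (D W V)\<close> for fields \<open>V\<close> that are defined only along the immersion
  (\<open>connection_along_parallel_endomorphism\<close>), whereas parallelism of \<open>P\<close> and the defining property of \<open>D\<close> concern
  fields on the ambient manifold. It requires expanding \<open>V\<close> in ambient fields with smooth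
  coefficients, and as tangent vectors are derivations of global smooth functions this rests on
  bump functions and Hadamard's lemma. They yield global smooth functions \<open>\<gamma>\<close> and \<open>y\<^sub>i\<close> and global vector
  fields \<open>Y\<^sub>i\<close>, with \<open>\<gamma>\<close> nonzero at a given point, such that \<open>\<gamma> v = \<Sum> v(y\<^sub>i) Y\<^sub>i\<close> for every
  tangent vector \<open>v\<close> of the manifold (\<open>exists_local_frame\<close>). Because this identity holds
  everywhere, it can be differentiated with \<open>D\<close> without a locality argument.
\<close>

section \<open>Calculus of smooth maps between Euclidean spaces\<close>

lemma Ck_on_subset: "Ck_on k f S \<Longrightarrow> T \<subseteq> S \<Longrightarrow> Ck_on k f T"
  by (induction k arbitrary: f) (auto intro: continuous_on_subset)

lemma Ck_on_cong:
  assumes "open S" "Ck_on k f S" "\<And>x. x \<in> S \<Longrightarrow> f x = h x"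
  shows "Ck_on k h S"
  using assms(2,3)
proof (induction k arbitrary: f h)
  case 0
  then show ?case using continuous_on_cong by (metis Ck_on.simps(1))
next
  case (Suc k)
  have d: "(h has_derivative frechet_derivative f (at x)) (at x)" if "x \<in> S" for x
    using has_derivative_transform_within_open[of f "frechet_derivative f (at x)" x UNIV S h]
      Suc.prems that assms(1) frechet_derivative_works by auto
  have e: "frechet_derivative h (at x) = frechet_derivative f (at x)" if "x \<in> S" for x
    using frechet_derivative_at[OF d[OF that]] by simp
  show ?case
    using Suc.IH[of "\<lambda>x. frechet_derivative f (at x) v" "\<lambda>x. frechet_derivative h (at x) v" for v]
      Suc.prems e d by (auto simp: differentiable_def) blast
qed

lemma Ck_on_local:
  assumes "\<And>x. x \<in> S \<Longrightarrow> \<exists>T. open T \<and> x \<in> T \<and> Ck_on k f T"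
  shows "Ck_on k f S"
  using assms
proof (induction k arbitrary: f)
  case 0
  then show ?case
    by (auto intro!: continuous_at_imp_continuous_on) (metis continuous_on_eq_continuous_at)
next
  case (Suc k)
  have "\<exists>T. open T \<and> x \<in> T \<and> Ck_on k (\<lambda>x. frechet_derivative f (at x) v) T" if "x \<in> S" for x v
    using Suc.prems[OF that] by auto
  then show ?case using Suc by fastforce
qed

text \<open>On an open set the recursion for \<open>Ck_on\<close> may be run with any family of derivatives,
  instead of the one chosen by \<open>frechet_derivative\<close>.\<close>
lemma Ck_on_SucI:
  assumes "open S" and d: "\<And>x. x \<in> S \<Longrightarrow> (f has_derivative f' x) (at x)"
    and "\<And>v. Ck_on k (\<lambda>x. f' x v) S"
  shows "Ck_on (Suc k) f S"
proof -
  have "frechet_derivative f (at x) = f' x" if "x \<in> S" for x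
    using frechet_derivative_at[OF d[OF that]] by simp
  then show ?thesis
    using assms Ck_on_cong[OF \<open>open S\<close> assms(3)] by (auto simp: differentiable_def)
qed

lemma Ck_on_SucD: "Ck_on (Suc k) f S \<Longrightarrow> Ck_on k f S"
proof (induction k arbitrary: f)
  case 0
  then show ?case
    by (auto intro!: continuous_at_imp_continuous_on differentiable_imp_continuous_within)
next
  case (Suc k)
  then show ?case by (metis Ck_on.simps(2))
qed

lemma Ck_on_Suc_has_derivative:
  "Ck_on (Suc k) f S \<Longrightarrow> x \<in> S \<Longrightarrow> (f has_derivative frechet_derivative f (at x)) (at x)"
  by (simp add: frechet_derivative_works)

lemma Ck_on_const [simp]: "Ck_on k (\<lambda>x. c) S"
proof (induction k arbitrary: c)
  case (Suc k)
  then show ?case by (simp add: frechet_derivative_const)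
qed simp

lemma Ck_on_bounded_linear: "open S \<Longrightarrow> bounded_linear L \<Longrightarrow> Ck_on k L S"
proof (cases k)
  case (Suc n)
  assume "open S" "bounded_linear L"
  then show ?thesis unfolding Suc
    by (intro Ck_on_SucI[where f' = "\<lambda>x. L"] bounded_linear_imp_has_derivative) auto
qed (simp add: linear_continuous_on)

lemma Ck_on_linear_image:
  assumes "open S" "bounded_linear L" "Ck_on k f S"
  shows "Ck_on k (\<lambda>x. L (f x)) S"
  using assms(3)
proof (induction k arbitrary: f)
  case 0
  then show ?case using bounded_linear.continuous_on[OF assms(2)] by simp
next
  case (Suc k)
  show ?case
  proof (rule Ck_on_SucI[where f' = "\<lambda>x v. L (frechet_derivative f (at x) v)"])
    show "((\<lambda>x. L (f x)) has_derivative (\<lambda>v. L (frechet_derivative f (at x) v))) (at x)"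
      if "x \<in> S" for x
      using Suc.prems that
      by (intro bounded_linear.has_derivative[OF assms(2)]) (simp add: frechet_derivative_works)
  qed (use assms(1) Suc in auto)
qed

lemma Ck_on_add:
  assumes "open S" "Ck_on k f S" "Ck_on k h S"
  shows "Ck_on k (\<lambda>x. f x + h x) S"
  using assms(2,3)
proof (induction k arbitrary: f h)
  case 0
  then show ?case by (auto intro: continuous_on_add)
next
  case (Suc k)
  show ?case
    by (rule Ck_on_SucI[where f' = "\<lambda>x v. frechet_derivative f (at x) v + frechet_derivative h (at x) v"])
      (use assms Suc in \<open>auto intro!: has_derivative_add simp: frechet_derivative_works\<close>)
qed

lemma Ck_on_sum:
  assumes "open S" "\<And>i. i \<in> I \<Longrightarrow> Ck_on k (f i) S"
  shows "Ck_on k (\<lambda>x. \<Sum>i\<in>I. f i x) S"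
  using assms(2) by (induction I rule: infinite_finite_induct) (auto intro: Ck_on_add assms(1))

lemma Ck_on_scaleR:
  fixes c :: "'e::euclidean_space \<Rightarrow> real"
  assumes "open S" "Ck_on k c S" "Ck_on k f S"
  shows "Ck_on k (\<lambda>x. c x *\<^sub>R f x) S"
  using assms(2,3)
proof (induction k arbitrary: c f)
  case 0
  then show ?case by (auto intro: continuous_on_scaleR)
next
  case (Suc k)
  show ?case
  proof (rule Ck_on_SucI[where f' = "\<lambda>x v. c x *\<^sub>R frechet_derivative f (at x) v
        + frechet_derivative c (at x) v *\<^sub>R f x"])
    fix x assume "x \<in> S"
    then show "((\<lambda>x. c x *\<^sub>R f x) has_derivative (\<lambda>v. c x *\<^sub>R frechet_derivative f (at x) v
        + frechet_derivative c (at x) v *\<^sub>R f x)) (at x)"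
      using Suc.prems by (auto intro!: has_derivative_scaleR simp: frechet_derivative_works)
  next
    fix v
    show "Ck_on k (\<lambda>x. c x *\<^sub>R frechet_derivative f (at x) v
        + frechet_derivative c (at x) v *\<^sub>R f x) S"
      by (intro Ck_on_add Suc.IH \<open>open S\<close> Ck_on_SucD[OF Suc.prems(1)] Ck_on_SucD[OF Suc.prems(2)])
        (use Suc.prems in auto)
  qed fact
qed

lemma Ck_on_mult:
  fixes f h :: "'e::euclidean_space \<Rightarrow> real"
  assumes "open S" "Ck_on k f S" "Ck_on k h S"
  shows "Ck_on k (\<lambda>x. f x * h x) S"
  using Ck_on_scaleR[OF assms] by simp

text \<open>By the chain rule and expansion in the basis of the intermediate space, a directional
  derivative of the composition is a sum of products of \<open>k\<close> times differentiable functions with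
  compositions of derivatives of \<open>h\<close> with \<open>f\<close>. The induction is therefore on \<open>k\<close> for all \<open>h\<close>
  at once.\<close>
lemma Ck_on_compose:
  fixes f :: "'e::euclidean_space \<Rightarrow> 'f::euclidean_space"
  assumes "open S" "open T" "f ` S \<subseteq> T" "Ck_on k f S" "Ck_on k h T"
  shows "Ck_on k (\<lambda>x. h (f x)) S"
  using assms(4,5)
proof (induction k arbitrary: h)
  case 0
  then show ?case using assms(3) continuous_on_compose2[of T h S f] by simp
next
  case (Suc k)
  let ?f' = "\<lambda>x. frechet_derivative f (at x)" and ?h' = "\<lambda>y. frechet_derivative h (at y)"
  show ?case
  proof (rule Ck_on_SucI[where f' = "\<lambda>x v. \<Sum>b\<in>Basis. (?f' x v \<bullet> b) *\<^sub>R ?h' (f x) b"])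
    fix x assume x: "x \<in> S"
    have h: "(h has_derivative ?h' (f x)) (at (f x))"
      using Suc.prems(2) x assms(3) by (intro Ck_on_Suc_has_derivative) auto
    have lin: "linear (?h' (f x))" using h has_derivative_linear by blast
    have "((\<lambda>x. h (f x)) has_derivative (\<lambda>v. ?h' (f x) (?f' x v))) (at x)"
      using has_derivative_compose[OF Ck_on_Suc_has_derivative[OF Suc.prems(1) x] h] .
    moreover have "?h' (f x) (?f' x v) = (\<Sum>b\<in>Basis. (?f' x v \<bullet> b) *\<^sub>R ?h' (f x) b)" for v
      by (subst euclidean_representation[of "?f' x v", symmetric])
        (simp only: linear_sum[OF lin] linear_scale[OF lin])
    ultimately show "((\<lambda>x. h (f x)) has_derivative
        (\<lambda>v. \<Sum>b\<in>Basis. (?f' x v \<bullet> b) *\<^sub>R ?h' (f x) b)) (at x)" by simp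
  next
    fix v
    have "Ck_on k (\<lambda>x. ?f' x v) S" "Ck_on k (\<lambda>y. ?h' y b) T" for b
      using Suc.prems by auto
    then have "Ck_on k (\<lambda>x. (?f' x v \<bullet> b) *\<^sub>R ?h' (f x) b) S" for b
      by (intro Ck_on_scaleR[OF \<open>open S\<close>] Ck_on_linear_image[OF \<open>open S\<close> bounded_linear_inner_left]
          Suc.IH[OF Ck_on_SucD[OF Suc.prems(1)]])
    then show "Ck_on k (\<lambda>x. \<Sum>b\<in>Basis. (?f' x v \<bullet> b) *\<^sub>R ?h' (f x) b) S"
      by (intro Ck_on_sum[OF \<open>open S\<close>])
  qed fact
qed

lemma Ck_on_inverse: "Ck_on k (inverse :: real \<Rightarrow> real) (- {0})"
proof (induction k)
  case 0
  then show ?case by (auto intro: continuous_on_inverse continuous_on_id)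
next
  case (Suc k)
  have o: "open (- {0::real})" by auto
  show ?case
  proof (rule Ck_on_SucI[where f' = "\<lambda>x v. (- v) * (inverse x * inverse x)"])
    show "Ck_on k (\<lambda>x. (- v) * (inverse x * inverse x)) (- {0})" for v :: real
      by (intro Ck_on_mult o Suc) simp
  qed (auto intro!: derivative_eq_intros simp: algebra_simps)
qed

lemma smooth_on_subset: "smooth_on S f \<Longrightarrow> T \<subseteq> S \<Longrightarrow> smooth_on T f"
  unfolding smooth_on_def using Ck_on_subset by blast

lemma smooth_on_cong:
  "open S \<Longrightarrow> smooth_on S f \<Longrightarrow> (\<And>x. x \<in> S \<Longrightarrow> f x = h x) \<Longrightarrow> smooth_on S h"
  unfolding smooth_on_def using Ck_on_cong by blast

lemma smooth_on_local:
  "(\<And>x. x \<in> S \<Longrightarrow> \<exists>T. open T \<and> x \<in> T \<and> smooth_on T f) \<Longrightarrow> smooth_on S f"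
  unfolding smooth_on_def using Ck_on_local by meson

lemma smooth_on_const [simp]: "smooth_on S (\<lambda>x. c)"
  unfolding smooth_on_def by simp

lemma smooth_on_add:
  "open S \<Longrightarrow> smooth_on S f \<Longrightarrow> smooth_on S h \<Longrightarrow> smooth_on S (\<lambda>x. f x + h x)"
  unfolding smooth_on_def using Ck_on_add by blast

lemma smooth_on_mult:
  fixes f h :: "'e::euclidean_space \<Rightarrow> real"
  shows "open S \<Longrightarrow> smooth_on S f \<Longrightarrow> smooth_on S h \<Longrightarrow> smooth_on S (\<lambda>x. f x * h x)"
  unfolding smooth_on_def using Ck_on_mult by blast

lemma smooth_on_compose:
  fixes f :: "'e::euclidean_space \<Rightarrow> 'f::euclidean_space"
  shows "open S \<Longrightarrow> open T \<Longrightarrow> f ` S \<subseteq> T \<Longrightarrow> smooth_on S f \<Longrightarrow> smooth_on T h \<Longrightarrow>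
    smooth_on S (\<lambda>x. h (f x))"
  unfolding smooth_on_def using Ck_on_compose by blast

lemma smooth_on_inner: "open S \<Longrightarrow> smooth_on S (\<lambda>x. x \<bullet> b)"
  unfolding smooth_on_def by (simp add: Ck_on_bounded_linear bounded_linear_inner_left)

lemma smooth_on_frechet_derivative:
  "smooth_on S f \<Longrightarrow> smooth_on S (\<lambda>x. frechet_derivative f (at x) v)"
  unfolding smooth_on_def by (metis Ck_on.simps(2))

lemma smooth_on_has_derivative:
  "smooth_on S f \<Longrightarrow> x \<in> S \<Longrightarrow> (f has_derivative frechet_derivative f (at x)) (at x)"
  unfolding smooth_on_def by (meson Ck_on_Suc_has_derivative)

section \<open>Bump functions and Hadamard's lemma\<close>

text \<open>For \<open>m = 0\<close> this is Cauchy's flat function. The extra powers of \<open>1/t\<close> make the family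
  closed under differentiation up to linear combinations, which turns smoothness into a plain
  induction.\<close>
definition flat_exp :: "nat \<Rightarrow> real \<Rightarrow> real" where
  "flat_exp m t = (if t > 0 then inverse t ^ m * exp (- inverse t) else 0)"

lemma flat_exp_tendsto_0: "(flat_exp m \<longlongrightarrow> 0) (at 0)"
proof -
  have "((\<lambda>t. t ^ m / exp t) \<longlongrightarrow> 0) (at_top::real filter)"
    by (rule tendsto_power_div_exp_0)
  then have "((\<lambda>t. inverse t ^ m / exp (inverse t)) \<longlongrightarrow> 0) (at_right (0::real))"
    using filterlim_compose filterlim_inverse_at_top_right by blast
  then have "(flat_exp m \<longlongrightarrow> 0) (at_right 0)"
    by (rule Lim_transform_eventually)
      (auto simp: eventually_at_right_field flat_exp_def exp_minus field_simps intro: exI[of _ 1])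
  moreover have "(flat_exp m \<longlongrightarrow> 0) (at_left 0)"
    by (rule Lim_transform_eventually[OF tendsto_const])
      (auto simp: eventually_at_left_field flat_exp_def intro: exI[of _ "-1"])
  ultimately show ?thesis using filterlim_split_at by blast
qed

text \<open>At 0 the difference quotient of one member of the family is the next member, so
  differentiability there is the limit computed above.\<close>
lemma flat_exp_has_derivative:
  "(flat_exp m has_real_derivative (flat_exp (m + 2) t - m * flat_exp (m + 1) t)) (at t)"
proof -
  consider "t > 0" | "t < 0" | "t = 0" by linarith
  then show ?thesis
  proof cases
    case 1
    have *: "((\<lambda>t. inverse t ^ m * exp (- inverse t)) has_real_derivative
        (flat_exp (m + 2) t - m * flat_exp (m + 1) t)) (at t)"
      using 1 by (cases m) (auto intro!: derivative_eq_intros simp: flat_exp_def field_simps,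
          metis One_nat_def power_eq_if)
    show ?thesis
      by (rule DERIV_cong_ev[THEN iffD1, OF refl _ refl *])
        (use 1 in \<open>auto simp: flat_exp_def eventually_nhds intro!: exI[of _ "{0<..}"]\<close>)
  next
    case 2
    have *: "((\<lambda>t. 0) has_real_derivative (flat_exp (m + 2) t - m * flat_exp (m + 1) t)) (at t)"
      using 2 by (simp add: flat_exp_def)
    show ?thesis
      by (rule DERIV_cong_ev[THEN iffD1, OF refl _ refl *])
        (use 2 in \<open>auto simp: flat_exp_def eventually_nhds intro!: exI[of _ "{..<0}"]\<close>)
  next
    case 3
    have "flat_exp (Suc m) h = (flat_exp m (0 + h) - flat_exp m 0) / h" for h
      by (simp add: flat_exp_def field_simps)
    then have "(\<lambda>h. (flat_exp m (0 + h) - flat_exp m 0) / h) = flat_exp (Suc m)" by auto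
    then show ?thesis
      using 3 flat_exp_tendsto_0[of "Suc m"] by (simp add: DERIV_def) (simp add: flat_exp_def)
  qed
qed

lemma smooth_on_flat_exp: "smooth_on UNIV (flat_exp m)"
proof -
  have "Ck_on k (flat_exp m) UNIV" for k
  proof (induction k arbitrary: m)
    case 0
    show ?case
      using DERIV_continuous[OF flat_exp_has_derivative] by (simp add: continuous_at_imp_continuous_on)
  next
    case (Suc k)
    show ?case
    proof (rule Ck_on_SucI[where f' = "\<lambda>t v. v * (flat_exp (m + 2) t + (- real m) * flat_exp (m + 1) t)"])
      show "Ck_on k (\<lambda>t. v * (flat_exp (m + 2) t + (- real m) * flat_exp (m + 1) t)) UNIV" for v
        by (intro Ck_on_mult Ck_on_add Suc open_UNIV Ck_on_const)
      show "(flat_exp m has_derivative (\<lambda>v. v * (flat_exp (m + 2) t + (- real m) * flat_exp (m + 1) t))) (at t)" for t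
        using flat_exp_has_derivative[of m t] by (simp add: has_field_derivative_def mult_commute_abs)
    qed simp
  qed
  then show ?thesis by (simp add: smooth_on_def)
qed

definition bump :: "'e::euclidean_space \<Rightarrow> real \<Rightarrow> 'e \<Rightarrow> real" where
  "bump c r z = flat_exp 0 (r\<^sup>2 - (z - c) \<bullet> (z - c))"

lemma smooth_on_bump: "smooth_on UNIV (bump c r)"
proof -
  have "smooth_on UNIV (\<lambda>z. (-1) * (z \<bullet> b + (- (c \<bullet> b))) * (z \<bullet> b + (- (c \<bullet> b))))" for b
    by (intro smooth_on_mult smooth_on_add smooth_on_const smooth_on_inner open_UNIV)
  then have *: "smooth_on UNIV (\<lambda>z. \<Sum>b\<in>Basis. (-1) * (z \<bullet> b + (- (c \<bullet> b))) * (z \<bullet> b + (- (c \<bullet> b))))"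
    unfolding smooth_on_def by (auto intro: Ck_on_sum)
  have "smooth_on UNIV (\<lambda>z. flat_exp 0 (r\<^sup>2 +
      (\<Sum>b\<in>Basis. (-1) * (z \<bullet> b + (- (c \<bullet> b))) * (z \<bullet> b + (- (c \<bullet> b))))))"
    by (rule smooth_on_compose[OF open_UNIV open_UNIV _ _ smooth_on_flat_exp])
      (auto intro: smooth_on_add *[simplified])
  moreover have "r\<^sup>2 + (\<Sum>b\<in>Basis. (-1) * (z \<bullet> b + (- (c \<bullet> b))) * (z \<bullet> b + (- (c \<bullet> b))))
      = r\<^sup>2 - (z - c) \<bullet> (z - c)" for z
    unfolding euclidean_inner[of "z - c" "z - c"]
    by (simp add: inner_diff_left sum_negf[symmetric] sum_subtractf algebra_simps)
  ultimately show ?thesis by (simp add: bump_def[abs_def])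
qed

lemma bump_center: "r > 0 \<Longrightarrow> bump c r c \<noteq> 0"
  by (simp add: bump_def flat_exp_def)

lemma bump_eq_0: "r > 0 \<Longrightarrow> z \<notin> cball c r \<Longrightarrow> bump c r z = 0"
proof -
  assume "r > 0" "z \<notin> cball c r"
  then have "r < norm (z - c)" by (simp add: dist_norm norm_minus_commute)
  with \<open>r > 0\<close> have "r\<^sup>2 \<le> (norm (z - c))\<^sup>2" by (intro power_mono) auto
  then show ?thesis by (simp add: bump_def flat_exp_def power2_norm_eq_inner)
qed

text \<open>Differentiating under the integral sign along a direction \<open>v\<close> replaces \<open>G\<close> by its derivative
  along \<open>v\<close> and raises the power of \<open>t\<close> by one. The weight \<open>t ^ m\<close> is there to make this
  an induction on \<open>k\<close>.\<close>
lemma Ck_on_ray_average: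
  fixes G :: "'e::euclidean_space \<Rightarrow> real"
  assumes U: "open U" "convex U" "c \<in> U" and G: "Ck_on k G U"
  shows "Ck_on k (\<lambda>z. integral {0..1} (\<lambda>t. t ^ m * G (c + t *\<^sub>R (z - c)))) U"
  using G
proof (induction k arbitrary: m G)
  case (0 m G)
  have ray: "c + t *\<^sub>R (z - c) \<in> U" if "z \<in> U" "t \<in> {0..1}" for z t
    using convexD_alt[OF U(2) U(3) that(1), of t] that(2) by (simp add: algebra_simps)
  have "continuous_on (U \<times> cbox 0 1) (\<lambda>q. c + snd q *\<^sub>R (fst q - c))"
    by (intro continuous_intros)
  from continuous_on_compose2[OF 0[simplified] this]
  have "continuous_on (U \<times> cbox 0 1) (\<lambda>q. G (c + snd q *\<^sub>R (fst q - c)))"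
    using ray by (force simp: image_subset_iff)
  then have "continuous_on (U \<times> cbox 0 1) (\<lambda>(z, t). t ^ m * G (c + t *\<^sub>R (z - c)))"
    unfolding case_prod_beta by (intro continuous_on_mult continuous_on_power continuous_on_snd continuous_on_id)
  from integral_continuous_on_param[OF this] show ?case by simp
next
  case (Suc k m G)
  have ray: "c + t *\<^sub>R (z - c) \<in> U" if "z \<in> U" "t \<in> {0..1}" for z t
    using convexD_alt[OF U(2) U(3) that(1), of t] that(2) by (simp add: algebra_simps)
  let ?G' = "\<lambda>y. frechet_derivative G (at y)"
  define F where "F = (\<lambda>z t. t ^ m * G (c + t *\<^sub>R (z - c)))"
  define F' where "F' = (\<lambda>z t. (t ^ Suc m) *\<^sub>R Blinfun (?G' (c + t *\<^sub>R (z - c))))"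
  have G': "(G has_derivative ?G' y) (at y)" if "y \<in> U" for y
    using Ck_on_Suc_has_derivative[OF Suc.prems that] .
  have bl: "blinfun_apply (Blinfun (?G' y)) = ?G' y" if "y \<in> U" for y
    using bounded_linear_Blinfun_apply[OF has_derivative_bounded_linear[OF G'[OF that]]] .
  have lin: "?G' y (t *\<^sub>R v) = t * ?G' y v" if "y \<in> U" for y t v
    using linear_scale[OF has_derivative_linear[OF G'[OF that]]] by simp
  have F': "blinfun_apply (F' z t) v = t ^ Suc m * ?G' (c + t *\<^sub>R (z - c)) v"
    if "z \<in> U" "t \<in> {0..1}" for z t v
    using bl[OF ray[OF that]] by (simp add: F'_def blinfun.scaleR_left)
  have cG: "continuous_on U G" using Ck_on_SucD[OF Suc.prems]
    using Suc.prems by (auto intro!: continuous_at_imp_continuous_on differentiable_imp_continuous_within)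
  have cG': "continuous_on U (\<lambda>y. ?G' y v)" for v
  proof -
    have "Ck_on k (\<lambda>y. ?G' y v) U" using Suc.prems by simp
    then have "Ck_on 0 (\<lambda>y. ?G' y v) U" by (induction k) (use Ck_on_SucD in blast)+
    then show ?thesis by simp
  qed
  have ray_cont: "continuous_on (U \<times> cbox 0 1) (\<lambda>q. c + snd q *\<^sub>R (fst q - c))"
    by (intro continuous_intros)
  have cont: "continuous_on (U \<times> cbox 0 1) (\<lambda>(z, t). F' z t)"
  proof (rule continuous_on_blinfun_componentwise)
    fix i :: 'e
    have "continuous_on (U \<times> cbox 0 1) (\<lambda>q. ?G' (c + snd q *\<^sub>R (fst q - c)) i)"
      by (rule continuous_on_compose2[OF cG' ray_cont]) (use ray in auto)
    then have "continuous_on (U \<times> cbox 0 1) (\<lambda>q. snd q ^ Suc m * ?G' (c + snd q *\<^sub>R (fst q - c)) i)"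
      by (intro continuous_on_mult continuous_on_power continuous_on_snd continuous_on_id)
    then show "continuous_on (U \<times> cbox 0 1) (\<lambda>x. blinfun_apply (case x of (z, t) \<Rightarrow> F' z t) i)"
      by (rule continuous_on_eq) (auto simp: F')
  qed
  have int: "(F z) integrable_on cbox 0 1" if "z \<in> U" for z
  proof -
    have "continuous_on (cbox 0 1) (\<lambda>t::real. c + t *\<^sub>R (z - c))"
      by (intro continuous_intros)
    from continuous_on_compose2[OF cG this]
    have "continuous_on (cbox 0 1) (\<lambda>t. G (c + t *\<^sub>R (z - c)))"
      using ray that by (force simp: image_subset_iff)
    then show ?thesis unfolding F_def
      by (intro integrable_continuous continuous_on_mult continuous_on_power continuous_on_id)
  qed
  have dF: "((\<lambda>z. F z t) has_derivative blinfun_apply (F' z t)) (at z within U)"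
    if z: "z \<in> U" "t \<in> cbox 0 1" for z t
  proof -
    have t: "t \<in> {0..1}" using z by simp
    have "((\<lambda>z. c + t *\<^sub>R (z - c)) has_derivative (\<lambda>v. t *\<^sub>R v)) (at z)"
      by (auto intro!: derivative_eq_intros)
    from has_derivative_compose[OF this G'[OF ray[OF z(1) t]]]
    have "((\<lambda>z. G (c + t *\<^sub>R (z - c))) has_derivative (\<lambda>v. t * ?G' (c + t *\<^sub>R (z - c)) v)) (at z)"
      by (simp add: lin[OF ray[OF z(1) t]])
    from has_derivative_mult_right[OF this, of "t ^ m"]
    have "((\<lambda>z. F z t) has_derivative (\<lambda>v. t ^ Suc m * ?G' (c + t *\<^sub>R (z - c)) v)) (at z)"
      by (simp add: F_def mult.left_commute mult.assoc mult.commute)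
    moreover have "(\<lambda>v. t ^ Suc m * ?G' (c + t *\<^sub>R (z - c)) v) = blinfun_apply (F' z t)"
      using F'[OF z(1) t] by auto
    ultimately show ?thesis using has_derivative_at_withinI by metis
  qed
  have der: "((\<lambda>z. integral {0..1} (F z)) has_derivative
      (\<lambda>v. integral {0..1} (\<lambda>t. t ^ Suc m * ?G' (c + t *\<^sub>R (z - c)) v))) (at z)" if z: "z \<in> U" for z
  proof -
    have "((\<lambda>z. integral (cbox 0 1) (F z)) has_derivative integral (cbox 0 1) (F' z)) (at z within U)"
      by (rule leibniz_rule[OF dF int cont z U(2)])
    moreover have "(F' z) integrable_on cbox 0 1"
    proof (rule integrable_continuous)
      have "continuous_on (cbox 0 1) (\<lambda>t. (z, t))"
        by (intro continuous_on_Pair continuous_on_const continuous_on_id)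
      from continuous_on_compose2[OF cont this]
      have "continuous_on (cbox 0 1) (\<lambda>t. case (z, t) of (z, t) \<Rightarrow> F' z t)"
        using z by (force simp: image_subset_iff)
      then show "continuous_on (cbox 0 1) (F' z)" by simp
    qed
    then have "blinfun_apply (integral (cbox 0 1) (F' z)) v
        = integral (cbox 0 1) (\<lambda>t. t ^ Suc m * ?G' (c + t *\<^sub>R (z - c)) v)" for v
      unfolding blinfun_apply_integral[OF \<open>F' z integrable_on cbox 0 1\<close>]
      by (intro integral_cong) (use F'[OF z] in auto)
    then have "blinfun_apply (integral (cbox 0 1) (F' z))
        = (\<lambda>v. integral {0..1} (\<lambda>t. t ^ Suc m * ?G' (c + t *\<^sub>R (z - c)) v))" by auto
    ultimately show ?thesis
      using at_within_open[OF z U(1)] by simp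
  qed
  have "Ck_on (Suc k) (\<lambda>z. integral {0..1} (F z)) U"
    by (rule Ck_on_SucI[OF U(1) der Suc.IH]) (use Suc.prems in auto)
  then show ?case unfolding F_def .
qed

lemma smooth_on_ray_average:
  fixes G :: "'e::euclidean_space \<Rightarrow> real"
  assumes "open U" "convex U" "c \<in> U" "smooth_on U G"
  shows "smooth_on U (\<lambda>z. integral {0..1} (\<lambda>t. G (c + t *\<^sub>R (z - c))))"
  using Ck_on_ray_average[where m = 0, OF assms(1-3)] assms(4) by (simp add: smooth_on_def)

text \<open>The fundamental theorem of calculus along the segment from \<open>c\<close> to \<open>z\<close>.\<close>
lemma Hadamard:
  fixes G :: "'e::euclidean_space \<Rightarrow> real"
  assumes U: "open U" "convex U" "c \<in> U" and G: "smooth_on U G" and z: "z \<in> U"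
  shows "G z - G c = (\<Sum>b\<in>Basis. ((z - c) \<bullet> b) *
    integral {0..1} (\<lambda>t. frechet_derivative G (at (c + t *\<^sub>R (z - c))) b))"
proof -
  let ?G' = "\<lambda>y. frechet_derivative G (at y)"
  have ray: "c + t *\<^sub>R (z - c) \<in> U" if "t \<in> {0..1}" for t
    using convexD_alt[OF U(2) U(3) z, of t] that by (simp add: algebra_simps)
  have G': "(G has_derivative ?G' y) (at y)" if "y \<in> U" for y
    using smooth_on_has_derivative[OF G that] .
  have int: "(\<lambda>t. ?G' (c + t *\<^sub>R (z - c)) b) integrable_on {0..1}" for b
  proof -
    have "continuous_on U (\<lambda>y. ?G' y b)"
      using smooth_on_frechet_derivative[OF G, of b] unfolding smooth_on_def by (metis Ck_on.simps(1))
    moreover have "continuous_on {0..1} (\<lambda>t::real. c + t *\<^sub>R (z - c))"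
      by (intro continuous_intros)
    ultimately have "continuous_on {0..1} (\<lambda>t. ?G' (c + t *\<^sub>R (z - c)) b)"
      by (rule continuous_on_compose2) (use ray in auto)
    then show ?thesis by (rule integrable_continuous_real)
  qed
  have "((\<lambda>t. G (c + t *\<^sub>R (z - c))) has_vector_derivative ?G' (c + t *\<^sub>R (z - c)) (z - c))
      (at t within {0..1})" if "t \<in> {0..1}" for t
  proof -
    have "((\<lambda>t. c + t *\<^sub>R (z - c)) has_derivative (\<lambda>s. s *\<^sub>R (z - c))) (at t)"
      by (auto intro!: derivative_eq_intros)
    from has_derivative_compose[OF this G'[OF ray[OF that]]] show ?thesis
      using linear_scale[OF has_derivative_linear[OF G'[OF ray[OF that]]]]
      by (simp add: has_vector_derivative_def has_derivative_at_withinI)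
  qed
  then have "((\<lambda>t. ?G' (c + t *\<^sub>R (z - c)) (z - c)) has_integral (G z - G c)) {0..1}"
    using fundamental_theorem_of_calculus[of 0 1 "\<lambda>t. G (c + t *\<^sub>R (z - c))"] by simp
  then have "G z - G c = integral {0..1} (\<lambda>t. ?G' (c + t *\<^sub>R (z - c)) (z - c))"
    by (simp add: integral_unique)
  also have "\<dots> = integral {0..1} (\<lambda>t. \<Sum>b\<in>Basis. ((z - c) \<bullet> b) * ?G' (c + t *\<^sub>R (z - c)) b)"
  proof (rule integral_cong)
    fix t :: real assume "t \<in> {0..1}"
    then have lin: "linear (?G' (c + t *\<^sub>R (z - c)))"
      using has_derivative_linear[OF G'[OF ray]] by blast
    have "?G' (c + t *\<^sub>R (z - c)) w = (\<Sum>b\<in>Basis. (w \<bullet> b) * ?G' (c + t *\<^sub>R (z - c)) b)" for w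
      by (subst (1) euclidean_representation[of w, symmetric])
        (simp only: linear_sum[OF lin] linear_scale[OF lin] real_scaleR_def)
    then show "?G' (c + t *\<^sub>R (z - c)) (z - c)
        = (\<Sum>b\<in>Basis. ((z - c) \<bullet> b) * ?G' (c + t *\<^sub>R (z - c)) b)" .
  qed
  also have "\<dots> = (\<Sum>b\<in>Basis. ((z - c) \<bullet> b) * integral {0..1} (\<lambda>t. ?G' (c + t *\<^sub>R (z - c)) b))"
    using int by (subst integral_sum) (auto intro: integrable_on_mult_right)
  finally show ?thesis .
qed

section \<open>Smooth functions on a manifold\<close>

lemma smooth_manifold_chart:
  assumes "smooth_manifold A" "(D, \<phi>) \<in> A"
  shows "open D" "open (\<phi> ` D)" "homeomorphism D (\<phi> ` D) \<phi> (inv_into D \<phi>)"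
    "\<And>x. x \<in> D \<Longrightarrow> inv_into D \<phi> (\<phi> x) = x"
    "\<And>Q. open Q \<Longrightarrow> open (\<phi> ` (D \<inter> Q))"
    "\<And>U. open U \<Longrightarrow> open (D \<inter> \<phi> -` U)"
proof -
  show D: "open D" and im: "open (\<phi> ` D)"
    and h: "homeomorphism D (\<phi> ` D) \<phi> (inv_into D \<phi>)"
    using assms unfolding smooth_manifold_def by auto
  show inv: "inv_into D \<phi> (\<phi> x) = x" if "x \<in> D" for x
    using homeomorphism_apply1[OF h that] .
  show "open (\<phi> ` (D \<inter> Q))" if Q: "open Q" for Q
  proof -
    have "\<phi> ` (D \<inter> Q) = \<phi> ` D \<inter> inv_into D \<phi> -` Q" using inv by (auto simp: image_iff)
    then show ?thesis
      using continuous_open_preimage[OF homeomorphism_cont2[OF h] im Q] by simp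
  qed
  show "open (D \<inter> \<phi> -` U)" if U: "open U" for U
    using continuous_open_preimage[OF homeomorphism_cont1[OF h] D U] .
qed

lemma smooth_manifold_chart_at:
  assumes "smooth_manifold A" obtains D \<phi> where "(D, \<phi>) \<in> A" "x \<in> D"
  using assms unfolding smooth_manifold_def by fast

lemma smooth_manifold_transition:
  "smooth_manifold A \<Longrightarrow> (D, \<phi>) \<in> A \<Longrightarrow> (D', \<psi>) \<in> A \<Longrightarrow>
    smooth_on (\<phi> ` (D \<inter> D')) (\<psi> \<circ> inv_into D \<phi>)"
  unfolding smooth_manifold_def by fast

lemma smooth_funs_iff:
  "a \<in> smooth_funs A \<longleftrightarrow> (\<forall>(D, \<phi>)\<in>A. smooth_on (\<phi> ` D) (\<lambda>z. a (inv_into D \<phi> z)))"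
  by (simp add: smooth_funs_def smooth_fun_on_def comp_def)

lemma smooth_funs_chart:
  "a \<in> smooth_funs A \<Longrightarrow> (D, \<phi>) \<in> A \<Longrightarrow> smooth_on (\<phi> ` D) (\<lambda>z. a (inv_into D \<phi> z))"
  unfolding smooth_funs_iff by fast

lemma smooth_funs_const [simp]: "(\<lambda>x. c) \<in> smooth_funs A"
  by (auto simp: smooth_funs_iff)

lemma smooth_funs_add:
  "smooth_manifold A \<Longrightarrow> a \<in> smooth_funs A \<Longrightarrow> b \<in> smooth_funs A \<Longrightarrow> (\<lambda>x. a x + b x) \<in> smooth_funs A"
  unfolding smooth_funs_iff[of "\<lambda>x. a x + b x"]
  by (clarify, intro smooth_on_add smooth_manifold_chart(2)) (auto intro: smooth_funs_chart)

lemma smooth_funs_mult: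
  "smooth_manifold A \<Longrightarrow> a \<in> smooth_funs A \<Longrightarrow> b \<in> smooth_funs A \<Longrightarrow> (\<lambda>x. a x * b x) \<in> smooth_funs A"
  unfolding smooth_funs_iff[of "\<lambda>x. a x * b x"]
  by (clarify, intro smooth_on_mult smooth_manifold_chart(2)) (auto intro: smooth_funs_chart)

lemma smooth_funs_sum:
  assumes "smooth_manifold A" "\<And>i. i \<in> I \<Longrightarrow> a i \<in> smooth_funs A"
  shows "(\<lambda>x. \<Sum>i\<in>I. a i x) \<in> smooth_funs A"
  using assms(2)
  by (induction I rule: infinite_finite_induct) (auto intro: smooth_funs_add assms(1))

text \<open>Smoothness is local, and near a point where \<open>c\<close> does not vanish \<open>a\<close> is the quotient of the
  smooth functions \<open>c * a\<close> and \<open>c\<close>.\<close>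
lemma smooth_funs_divide:
  assumes A: "smooth_manifold A"
    and c: "\<And>p. \<exists>c\<in>smooth_funs A. c p \<noteq> 0 \<and> (\<lambda>x. c x * a x) \<in> smooth_funs A"
  shows "a \<in> smooth_funs A"
  unfolding smooth_funs_iff
proof (intro ballI, clarify, rule smooth_on_local)
  fix D \<phi> z assume ch: "(D, \<phi>) \<in> A" and z: "z \<in> \<phi> ` D"
  let ?i = "inv_into D \<phi>"
  obtain c where c: "c \<in> smooth_funs A" "c (?i z) \<noteq> 0" "(\<lambda>x. c x * a x) \<in> smooth_funs A"
    using c by blast
  note sc = smooth_funs_chart[OF c(1) ch] and sca = smooth_funs_chart[OF c(3) ch]
  have "continuous_on (\<phi> ` D) (\<lambda>z. c (?i z))"
    using sc unfolding smooth_on_def by (metis Ck_on.simps(1))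
  then have o: "open (\<phi> ` D \<inter> (\<lambda>z. c (?i z)) -` (- {0}))" (is "open ?T")
    using smooth_manifold_chart(2)[OF A ch] by (intro continuous_open_preimage) auto
  have "smooth_on (- {0}) (inverse :: real \<Rightarrow> real)"
    by (simp add: smooth_on_def Ck_on_inverse)
  moreover have "smooth_on ?T (\<lambda>z. c (?i z))" by (rule smooth_on_subset[OF sc]) auto
  moreover have "open (- {0::real})" "(\<lambda>z. c (?i z)) ` ?T \<subseteq> - {0}" by auto
  ultimately have "smooth_on ?T (\<lambda>z. inverse (c (?i z)))"
    by (intro smooth_on_compose[OF o, of "- {0}" "\<lambda>z. c (?i z)" inverse])
  moreover have "smooth_on ?T (\<lambda>z. c (?i z) * a (?i z))" by (rule smooth_on_subset[OF sca]) auto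
  ultimately have "smooth_on ?T (\<lambda>z. inverse (c (?i z)) * (c (?i z) * a (?i z)))"
    by (rule smooth_on_mult[OF o])
  then have "smooth_on ?T (\<lambda>z. a (?i z))"
    by (rule smooth_on_cong[OF o]) auto
  then show "\<exists>T. open T \<and> z \<in> T \<and> smooth_on T (\<lambda>z. a (?i z))"
    using o z c(2) by (intro exI[of _ ?T] conjI) auto
qed

lemma smooth_funs_pullback:
  assumes A: "smooth_manifold A" and B: "smooth_manifold B" and f: "smooth_map A B f"
    and a: "a \<in> smooth_funs B"
  shows "(\<lambda>p. a (f p)) \<in> smooth_funs A"
  unfolding smooth_funs_iff
proof (intro ballI, clarify, rule smooth_on_local)
  fix D \<phi> z assume ch: "(D, \<phi>) \<in> A" and z: "z \<in> \<phi> ` D"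
  let ?i = "inv_into D \<phi>"
  obtain D' \<psi> where ch': "(D', \<psi>) \<in> B" "f (?i z) \<in> D'" by (rule smooth_manifold_chart_at[OF B])
  have "continuous_on UNIV f" using f by (simp add: smooth_map_def)
  then have fD': "open (f -` D')" using smooth_manifold_chart(1)[OF B ch'(1)] open_vimage by blast
  let ?T = "\<phi> ` (D \<inter> f -` D')"
  have o: "open ?T" using smooth_manifold_chart(5)[OF A ch fD'] .
  have "smooth_on ?T (\<psi> \<circ> f \<circ> ?i)" using f ch ch'(1) unfolding smooth_map_def by fast
  moreover have "(\<psi> \<circ> f \<circ> ?i) ` ?T \<subseteq> \<psi> ` D'"
    by (auto simp: smooth_manifold_chart(4)[OF A ch])
  ultimately have "smooth_on ?T (\<lambda>z. a (inv_into D' \<psi> ((\<psi> \<circ> f \<circ> ?i) z)))"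
    by (intro smooth_on_compose[OF o smooth_manifold_chart(2)[OF B ch'(1)] _ _ smooth_funs_chart[OF a ch'(1)]])
  then have "smooth_on ?T (\<lambda>z. a (f (?i z)))"
    by (rule smooth_on_cong[OF o])
      (auto simp: smooth_manifold_chart(4)[OF A ch] smooth_manifold_chart(4)[OF B ch'(1)])
  moreover have "z \<in> ?T"
    using z ch'(2) smooth_manifold_chart(4)[OF A ch] by auto
  ultimately show "\<exists>T. open T \<and> z \<in> T \<and> smooth_on T (\<lambda>z. a (f (?i z)))"
    by (intro exI[of _ ?T] conjI o)
qed

definition extend_by_zero ::
  "'m set \<Rightarrow> ('m \<Rightarrow> 'e) \<Rightarrow> 'e set \<Rightarrow> ('e \<Rightarrow> real) \<Rightarrow> 'm \<Rightarrow> real" where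
  "extend_by_zero D \<phi> U F x = (if x \<in> D \<and> \<phi> x \<in> U then F (\<phi> x) else 0)"

text \<open>The preimage of \<open>K\<close> in the manifold is compact, hence closed by the Hausdorff property. So
  every point has a neighbourhood in which the extension is \<open>F\<close> in coordinates or is zero.\<close>
lemma smooth_funs_extend_by_zero:
  fixes A :: "('m::{t2_space, second_countable_topology}, 'e::euclidean_space) atlas"
  assumes A: "smooth_manifold A" and ch: "(D, \<phi>) \<in> A"
    and K: "compact K" "K \<subseteq> U" "open U" "U \<subseteq> \<phi> ` D"
    and F: "smooth_on U F" "\<And>z. z \<in> U - K \<Longrightarrow> F z = 0"
  shows "extend_by_zero D \<phi> U F \<in> smooth_funs A"
  unfolding smooth_funs_iff
proof (intro ballI, clarify, rule smooth_on_local)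
  let ?E = "extend_by_zero D \<phi> U F"
  fix D' \<psi> z assume ch': "(D', \<psi>) \<in> A" and z: "z \<in> \<psi> ` D'"
  let ?i = "inv_into D' \<psi>" and ?L = "inv_into D \<phi> ` K"
  note inv = smooth_manifold_chart(4)[OF A ch] and inv' = smooth_manifold_chart(4)[OF A ch']
  show "\<exists>T. open T \<and> z \<in> T \<and> smooth_on T (\<lambda>z. ?E (?i z))"
  proof (cases "?i z \<in> D \<and> \<phi> (?i z) \<in> U")
    case True
    let ?T = "\<psi> ` (D' \<inter> (D \<inter> \<phi> -` U))"
    have o: "open ?T"
      using smooth_manifold_chart(5)[OF A ch' smooth_manifold_chart(6)[OF A ch K(3)]] .
    have "smooth_on ?T (\<phi> \<circ> ?i)"
      by (rule smooth_on_subset[OF smooth_manifold_transition[OF A ch' ch]]) auto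
    moreover have "(\<phi> \<circ> ?i) ` ?T \<subseteq> U" by (auto simp: inv')
    ultimately have "smooth_on ?T (\<lambda>z. F ((\<phi> \<circ> ?i) z))"
      by (intro smooth_on_compose[OF o K(3) _ _ F(1)])
    then have "smooth_on ?T (\<lambda>z. ?E (?i z))"
      by (rule smooth_on_cong[OF o]) (auto simp: inv' extend_by_zero_def)
    moreover have "z \<in> ?T" using z True inv' by auto
    ultimately show ?thesis by (intro exI[of _ ?T] conjI o)
  next
    case False
    have "compact ?L"
      using homeomorphism_cont2[OF smooth_manifold_chart(3)[OF A ch]] K continuous_on_subset
      by (intro compact_continuous_image) blast+
    then have oL: "open (- ?L)" using compact_imp_closed by blast
    let ?T = "\<psi> ` (D' \<inter> - ?L)"
    have o: "open ?T" using smooth_manifold_chart(5)[OF A ch' oL] .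
    have "?i z \<notin> ?L"
    proof
      assume "?i z \<in> ?L"
      then obtain k where k: "k \<in> K" "?i z = inv_into D \<phi> k" by blast
      then have "k \<in> \<phi> ` D" using K by blast
      then show False using False k K inv_into_into[of k \<phi> D] f_inv_into_f[of k \<phi> D] by auto
    qed
    then have "z \<in> ?T" using z inv' by auto
    moreover have "?E y = 0" if "y \<notin> ?L" for y
    proof (cases "y \<in> D \<and> \<phi> y \<in> U")
      case True
      then have "\<phi> y \<notin> K" using that inv by (metis image_eqI)
      then show ?thesis using True F(2) by (simp add: extend_by_zero_def)
    qed (auto simp: extend_by_zero_def)
    then have "smooth_on ?T (\<lambda>z. ?E (?i z))"
      by (intro smooth_on_cong[OF o smooth_on_const[of _ 0]]) (auto simp: inv')
    ultimately show ?thesis by (intro exI[of _ ?T] conjI o)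
  qed
qed

section \<open>Tangent vectors\<close>

lemma tscale_apply [simp]: "(c *\<^sub>t v) a = c * v a"
  by (simp add: tscale_def)

lemma fun_sum_apply: "(\<Sum>i\<in>I. v i) a = (\<Sum>i\<in>I. v i a)"
  for v :: "'i \<Rightarrow> 'x \<Rightarrow> 'y::comm_monoid_add"
  by (induction I rule: infinite_finite_induct) auto

lemma minus_tscale: "- v = (-1) *\<^sub>t v"
  by (simp add: fun_eq_iff)

lemma tscale_left_zero [simp]: "0 *\<^sub>t v = 0"
  by (simp add: fun_eq_iff)

lemma tangent_space_plus: "u \<in> tangent_space A p \<Longrightarrow> v \<in> tangent_space A p \<Longrightarrow> u + v \<in> tangent_space A p"
  by (simp add: tangent_space_def algebra_simps)

lemma tangent_space_tscale: "u \<in> tangent_space A p \<Longrightarrow> c *\<^sub>t u \<in> tangent_space A p"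
  by (simp add: tangent_space_def algebra_simps)

lemma tangent_space_zero: "0 \<in> tangent_space A p"
  by (simp add: tangent_space_def)

lemma tangent_space_uminus: "u \<in> tangent_space A p \<Longrightarrow> - u \<in> tangent_space A p"
  unfolding minus_tscale by (rule tangent_space_tscale)

lemma tangent_space_diff: "u \<in> tangent_space A p \<Longrightarrow> v \<in> tangent_space A p \<Longrightarrow> u - v \<in> tangent_space A p"
  using tangent_space_plus[of u A p "- v"] tangent_space_uminus[of v A p] by simp

lemma tangent_space_sum:
  "(\<And>i. i \<in> I \<Longrightarrow> v i \<in> tangent_space A p) \<Longrightarrow> (\<Sum>i\<in>I. v i) \<in> tangent_space A p"
  by (induction I rule: infinite_finite_induct) (auto intro: tangent_space_plus tangent_space_zero)

lemma tangent_vector_add: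
  assumes "v \<in> tangent_space A p" "a \<in> smooth_funs A" "b \<in> smooth_funs A"
  shows "v (\<lambda>x. a x + b x) = v a + v b"
  using assms unfolding tangent_space_def plus_fun_def by blast

lemma tangent_vector_mult:
  assumes "v \<in> tangent_space A p" "a \<in> smooth_funs A" "b \<in> smooth_funs A"
  shows "v (\<lambda>x. a x * b x) = v a * b p + a p * v b"
  using assms unfolding tangent_space_def times_fun_def by blast

lemma tangent_vector_scale:
  assumes "v \<in> tangent_space A p" "a \<in> smooth_funs A"
  shows "v (\<lambda>x. c * a x) = c * v a"
  using assms unfolding tangent_space_def by blast

lemma tangent_vector_const: "v \<in> tangent_space A p \<Longrightarrow> v (\<lambda>x. c) = 0"
proof -
  assume v: "v \<in> tangent_space A p"
  have "v (\<lambda>x. 1) = 0" using tangent_vector_mult[OF v, of "\<lambda>x. 1" "\<lambda>x. 1"] by simp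
  then show ?thesis using tangent_vector_scale[OF v, of "\<lambda>x. 1" c] by simp
qed

lemma tangent_vector_sum:
  assumes A: "smooth_manifold A" and v: "v \<in> tangent_space A p"
    and "\<And>i. i \<in> I \<Longrightarrow> a i \<in> smooth_funs A"
  shows "v (\<lambda>x. \<Sum>i\<in>I. a i x) = (\<Sum>i\<in>I. v (a i))"
  using assms(3)
  by (induction I rule: infinite_finite_induct)
    (auto simp: tangent_vector_const[OF v] tangent_vector_add[OF v] smooth_funs_sum[OF A])

lemma push_plus: "push B f (u + v) = push B f u + push B f v"
  by (auto simp: push_def fun_eq_iff)

lemma push_diff: "push B f (u - v) = push B f u - push B f v"
  by (auto simp: push_def fun_eq_iff)

lemma push_zero [simp]: "push B f 0 = 0"
  by (auto simp: push_def fun_eq_iff)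

lemma push_tangent_space:
  assumes A: "smooth_manifold A" and B: "smooth_manifold B" and f: "smooth_map A B f"
    and u: "u \<in> tangent_space A p"
  shows "push B f u \<in> tangent_space B (f p)"
proof -
  note pb = smooth_funs_pullback[OF A B f]
  have "push B f u (a + b) = push B f u a + push B f u b \<and>
      push B f u (a * b) = push B f u a * b (f p) + a (f p) * push B f u b"
    if "a \<in> smooth_funs B" "b \<in> smooth_funs B" for a b
    using that smooth_funs_add[OF B that] smooth_funs_mult[OF B that]
      tangent_vector_add[OF u pb[OF that(1)] pb[OF that(2)]]
      tangent_vector_mult[OF u pb[OF that(1)] pb[OF that(2)]]
    by (simp add: push_def comp_def plus_fun_def times_fun_def)
  moreover have "push B f u (\<lambda>x. c * a x) = c * push B f u a" if "a \<in> smooth_funs B" for a c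
    using that smooth_funs_mult[OF B _ that, of "\<lambda>x. c"] tangent_vector_scale[OF u pb[OF that]]
    by (simp add: push_def comp_def)
  ultimately show ?thesis
    unfolding tangent_space_def by (simp add: push_def)
qed

lemma fields_along_iff:
  "V \<in> fields_along A B f \<longleftrightarrow> (\<forall>p. V p \<in> tangent_space B (f p)) \<and>
     (\<forall>a\<in>smooth_funs B. (\<lambda>p. V p a) \<in> smooth_funs A)"
  by (simp add: fields_along_on_def smooth_funs_def)

lemma fields_along_push:
  assumes "smooth_manifold A" "smooth_manifold B" "smooth_map A B f" "U \<in> vector_fields A"
  shows "(\<lambda>p. push B f (U p)) \<in> fields_along A B f"
  unfolding fields_along_iff
proof (intro conjI allI ballI)
  show "push B f (U p) \<in> tangent_space B (f p)" for p
    using assms by (intro push_tangent_space) (auto simp: fields_along_iff)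
  show "(\<lambda>p. push B f (U p) a) \<in> smooth_funs A" if "a \<in> smooth_funs B" for a
    using assms that smooth_funs_pullback[OF assms(1-3) that]
    by (simp add: fields_along_iff push_def comp_def)
qed

lemma fields_along_restrict:
  assumes "smooth_manifold A" "smooth_manifold B" "smooth_map A B f" "Y \<in> vector_fields B"
  shows "(\<lambda>p. Y (f p)) \<in> fields_along A B f"
  using assms smooth_funs_pullback[OF assms(1-3)] by (auto simp: fields_along_iff)

lemma fields_along_plus:
  "smooth_manifold A \<Longrightarrow> V \<in> fields_along A B f \<Longrightarrow> V' \<in> fields_along A B f \<Longrightarrow>
    V + V' \<in> fields_along A B f"
  by (auto simp: fields_along_iff tangent_space_plus smooth_funs_add)

lemma fields_along_tscale:
  "smooth_manifold A \<Longrightarrow> c \<in> smooth_funs A \<Longrightarrow> V \<in> fields_along A B f \<Longrightarrow>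
    (\<lambda>p. c p *\<^sub>t V p) \<in> fields_along A B f"
  by (auto simp: fields_along_iff tangent_space_tscale smooth_funs_mult)

lemma fields_along_zero: "0 \<in> fields_along A B f"
  by (auto simp: fields_along_iff tangent_space_zero)

lemma fields_along_sum:
  "smooth_manifold A \<Longrightarrow> (\<And>i. i \<in> I \<Longrightarrow> V i \<in> fields_along A B f) \<Longrightarrow>
    (\<Sum>i\<in>I. V i) \<in> fields_along A B f"
  by (induction I rule: infinite_finite_induct) (auto intro: fields_along_plus fields_along_zero)

section \<open>Local frames\<close>

text \<open>The coordinate field \<open>F \<partial>\<^sub>b\<close> extended by zero. Off the smooth functions it has to vanish,
  as tangent vectors do.\<close>
definition chart_field ::
  "('m, 'e::euclidean_space) atlas \<Rightarrow> 'm set \<Rightarrow> ('m \<Rightarrow> 'e) \<Rightarrow> 'e set \<Rightarrow> ('e \<Rightarrow> real) \<Rightarrow> 'e \<Rightarrow>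
   'm \<Rightarrow> 'm tvec" where
  "chart_field A D \<phi> U F b x = (\<lambda>a. if a \<in> smooth_funs A then
     extend_by_zero D \<phi> U
       (\<lambda>z. F z * frechet_derivative (\<lambda>z. a (inv_into D \<phi> z)) (at z) b) x else 0)"

lemma vector_fields_chart_field:
  fixes A :: "('m::{t2_space, second_countable_topology}, 'e::euclidean_space) atlas"
  assumes A: "smooth_manifold A" and ch: "(D, \<phi>) \<in> A"
    and K: "compact K" "K \<subseteq> U" "open U" "U \<subseteq> \<phi> ` D"
    and F: "smooth_on U F" "\<And>z. z \<in> U - K \<Longrightarrow> F z = 0"
  shows "chart_field A D \<phi> U F b \<in> vector_fields A"
  unfolding fields_along_iff
proof (intro conjI allI ballI)
  let ?i = "inv_into D \<phi>"
  fix x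
  show "chart_field A D \<phi> U F b x \<in> tangent_space A x"
  proof (cases "x \<in> D \<and> \<phi> x \<in> U")
    case False
    then have "chart_field A D \<phi> U F b x = 0"
      by (auto simp: chart_field_def extend_by_zero_def fun_eq_iff)
    then show ?thesis by (simp add: tangent_space_zero)
  next
    case True
    let ?d = "\<lambda>a. frechet_derivative (\<lambda>z. a (?i z)) (at (\<phi> x))"
    have inv: "?i (\<phi> x) = x" using smooth_manifold_chart(4)[OF A ch] True by blast
    have d: "((\<lambda>z. a (?i z)) has_derivative ?d a) (at (\<phi> x))" if "a \<in> smooth_funs A" for a
      using smooth_on_has_derivative[OF smooth_funs_chart[OF that ch]] True by blast
    have X: "chart_field A D \<phi> U F b x a = F (\<phi> x) * ?d a b" if "a \<in> smooth_funs A" for a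
      using True that by (simp add: chart_field_def extend_by_zero_def)
    have scale: "?d (\<lambda>x. c * a x) b = c * ?d a b" if "a \<in> smooth_funs A" for a c
      using fun_cong[OF frechet_derivative_at[OF has_derivative_mult_right[OF d[OF that], of c]], of b]
      by simp
    have add: "?d (\<lambda>x. a x + a' x) b = ?d a b + ?d a' b"
      if "a \<in> smooth_funs A" "a' \<in> smooth_funs A" for a a'
      using fun_cong[OF frechet_derivative_at[OF has_derivative_add[OF d[OF that(1)] d[OF that(2)]]], of b]
      by simp
    have mult: "?d (\<lambda>x. a x * a' x) b = a x * ?d a' b + ?d a b * a' x"
      if "a \<in> smooth_funs A" "a' \<in> smooth_funs A" for a a'
      using fun_cong[OF frechet_derivative_at[OF has_derivative_mult[OF d[OF that(1)] d[OF that(2)]]], of b]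
      by (simp add: inv)
    show ?thesis
      unfolding tangent_space_def plus_fun_def times_fun_def
    proof (intro CollectI conjI allI impI ballI)
      fix a assume "a \<notin> smooth_funs A"
      then show "chart_field A D \<phi> U F b x a = 0" by (simp add: chart_field_def)
    next
      fix a c assume a: "a \<in> smooth_funs A"
      then have "(\<lambda>x. c * a x) \<in> smooth_funs A" by (intro smooth_funs_mult A smooth_funs_const)
      then show "chart_field A D \<phi> U F b x (\<lambda>x. c * a x) = c * chart_field A D \<phi> U F b x a"
        using a scale by (simp add: X)
    next
      fix a a' assume a: "a \<in> smooth_funs A" "a' \<in> smooth_funs A"
      show "chart_field A D \<phi> U F b x (\<lambda>x. a x + a' x)
          = chart_field A D \<phi> U F b x a + chart_field A D \<phi> U F b x a'"
        using a add smooth_funs_add[OF A a] by (simp add: X algebra_simps)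
      show "chart_field A D \<phi> U F b x (\<lambda>x. a x * a' x)
          = chart_field A D \<phi> U F b x a * a' x + a x * chart_field A D \<phi> U F b x a'"
        using a mult smooth_funs_mult[OF A a] by (simp add: X algebra_simps)
    qed
  qed
next
  fix a assume a: "a \<in> smooth_funs A"
  have "smooth_on U (\<lambda>z. frechet_derivative (\<lambda>z. a (inv_into D \<phi> z)) (at z) b)"
    by (rule smooth_on_subset[OF smooth_on_frechet_derivative[OF smooth_funs_chart[OF a ch]] K(4)])
  then have "extend_by_zero D \<phi> U
      (\<lambda>z. F z * frechet_derivative (\<lambda>z. a (inv_into D \<phi> z)) (at z) b) \<in> smooth_funs A"
    by (intro smooth_funs_extend_by_zero[OF A ch K] smooth_on_mult[OF K(3) F(1)]) (simp_all add: F(2))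
  then show "(\<lambda>x. chart_field A D \<phi> U F b x a) \<in> smooth_funs A"
    using a by (simp add: chart_field_def)
qed

text \<open>Take a chart around \<open>q\<close>, a bump function \<open>\<beta>\<close> in it and the coordinates \<open>z\<^sub>b\<close>, and let
  \<open>u\<^sub>b = \<beta> z\<^sub>b\<close>. Hadamard's lemma at a point \<open>x\<close>, multiplied by \<open>\<beta>\<^sup>2\<close>, becomes the identity
  \<open>\<beta>\<^sup>2 (a - a(x)) = \<Sum>\<^sub>b (u\<^sub>b - z\<^sub>b(x) \<beta>) (\<beta> h\<^sub>b)\<close> between global smooth functions, where
  \<open>h\<^sub>b(x) = \<partial>\<^sub>b a(x)\<close>. A derivation \<open>v\<close> at \<open>x\<close> takes it to
  \<open>\<beta>(x)\<^sup>2 v(a) = \<Sum>\<^sub>b (v(u\<^sub>b) - z\<^sub>b(x) v(\<beta>)) \<beta>(x) \<partial>\<^sub>b a(x)\<close>. Hence \<open>\<gamma> = \<beta>\<^sup>2\<close> works with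
  \<open>u\<^sub>b\<close> paired with the field \<open>\<beta> \<partial>\<^sub>b\<close> and \<open>\<beta>\<close> paired with \<open>- z\<^sub>b \<beta> \<partial>\<^sub>b\<close>. The index \<open>(b, t)\<close>
  selects the former pair for \<open>t = True\<close> and the latter for \<open>t = False\<close>. Carrying
  the correction term for \<open>v(\<beta>)\<close> spares a bump function that is constant near \<open>q\<close>.\<close>
lemma exists_local_frame:
  fixes A :: "('m::{t2_space, second_countable_topology}, 'e::euclidean_space) atlas"
  assumes A: "smooth_manifold A"
  obtains I :: "('e \<times> bool) set" and \<gamma> y Y
  where "\<gamma> \<in> smooth_funs A" "\<gamma> q \<noteq> 0"
    and "\<And>i. i \<in> I \<Longrightarrow> y i \<in> smooth_funs A" "\<And>i. i \<in> I \<Longrightarrow> Y i \<in> vector_fields A"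
    and "\<And>x v. v \<in> tangent_space A x \<Longrightarrow> \<gamma> x *\<^sub>t v = (\<Sum>i\<in>I. v (y i) *\<^sub>t Y i x)"
proof -
  obtain D \<phi> where ch: "(D, \<phi>) \<in> A" and q: "q \<in> D" by (rule smooth_manifold_chart_at[OF A])
  let ?i = "inv_into D \<phi>"
  obtain R where R: "R > 0" "ball (\<phi> q) R \<subseteq> \<phi> ` D"
    using smooth_manifold_chart(2)[OF A ch] q open_contains_ball by blast
  define U where "U = ball (\<phi> q) R"
  define K where "K = cball (\<phi> q) (R / 2)"
  define \<beta> where "\<beta> = bump (\<phi> q) (R / 2)"
  have K: "compact K" "K \<subseteq> U" "open U" "U \<subseteq> \<phi> ` D" and convex: "convex U"
    using R by (auto simp: K_def U_def)
  have \<beta>: "smooth_on U \<beta>" "\<And>z. z \<in> U - K \<Longrightarrow> \<beta> z = 0"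
    using smooth_on_subset[OF smooth_on_bump] bump_eq_0[of "R / 2" _ "\<phi> q"] R
    by (auto simp: \<beta>_def K_def)
  let ?E = "extend_by_zero D \<phi> U"
  have E: "?E (\<lambda>z. \<beta> z * F z) \<in> smooth_funs A" if "smooth_on U F" for F
    by (intro smooth_funs_extend_by_zero[OF A ch K] smooth_on_mult[OF K(3) \<beta>(1) that])
      (simp add: \<beta>(2))
  have X: "chart_field A D \<phi> U (\<lambda>z. \<beta> z * F z) b \<in> vector_fields A" if "smooth_on U F" for F b
    by (intro vector_fields_chart_field[OF A ch K] smooth_on_mult[OF K(3) \<beta>(1) that])
      (simp add: \<beta>(2))
  define e where "e = ?E (\<lambda>z. \<beta> z * 1)"
  define u where "u = (\<lambda>b. ?E (\<lambda>z. \<beta> z * (z \<bullet> b)))"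
  define y where "y = (\<lambda>(b, t). if t then u b else e)"
  define Y where "Y = (\<lambda>(b, t). chart_field A D \<phi> U (\<lambda>z. \<beta> z * (if t then 1 else - (z \<bullet> b))) b)"
  have e: "e \<in> smooth_funs A" and u: "u b \<in> smooth_funs A" for b
    unfolding e_def u_def by (intro E smooth_on_const smooth_on_inner K(3))+
  have "smooth_on U (\<lambda>z. - (z \<bullet> b))" for b
    using smooth_on_mult[OF K(3) smooth_on_const[of U "-1"] smooth_on_inner[OF K(3)]] by simp
  then have "smooth_on U (\<lambda>z. if t then 1 else - (z \<bullet> b))" for b t by (cases t) simp_all
  from X[OF this] have Y: "Y i \<in> vector_fields A" for i
    unfolding Y_def by (cases i) (simp only: prod.case)
  have frame: "(e x * e x) *\<^sub>t v = (\<Sum>i\<in>Basis \<times> UNIV. v (y i) *\<^sub>t Y i x)"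
    if v: "v \<in> tangent_space A x" for x v
  proof
    fix a
    have split: "(\<Sum>i\<in>Basis \<times> UNIV. v (y i) *\<^sub>t Y i x) a =
        (\<Sum>b\<in>Basis. v (u b) * Y (b, True) x a + v e * Y (b, False) x a)"
      by (simp add: fun_sum_apply sum.cartesian_product' UNIV_bool y_def add.commute)
    show "((e x * e x) *\<^sub>t v) a = (\<Sum>i\<in>Basis \<times> UNIV. v (y i) *\<^sub>t Y i x) a"
    proof (cases "a \<in> smooth_funs A \<and> x \<in> D \<and> \<phi> x \<in> U")
      case False
      then have "Y i x a = 0" for i
        by (auto simp: Y_def chart_field_def extend_by_zero_def split: prod.split)
      moreover have "e x = 0 \<or> v a = 0"
        using False v by (auto simp: e_def extend_by_zero_def tangent_space_def)
      ultimately show ?thesis unfolding split by auto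
    next
      case True
      then have a: "a \<in> smooth_funs A" and x: "x \<in> D" "\<phi> x \<in> U" by auto
      let ?G = "\<lambda>z. a (?i z)"
      define h where "h = (\<lambda>b z. integral {0..1}
        (\<lambda>t. frechet_derivative ?G (at (\<phi> x + t *\<^sub>R (z - \<phi> x))) b))"
      define H where "H = (\<lambda>b. ?E (\<lambda>z. \<beta> z * h b z))"
      have G: "smooth_on U ?G" by (rule smooth_on_subset[OF smooth_funs_chart[OF a ch] K(4)])
      have "smooth_on U (h b)" for b
        unfolding h_def
        by (rule smooth_on_ray_average[OF K(3) convex x(2) smooth_on_frechet_derivative[OF G]])
      then have H: "H b \<in> smooth_funs A" for b unfolding H_def by (rule E)
      have Hx: "H b x = \<beta> (\<phi> x) * frechet_derivative ?G (at (\<phi> x)) b" for b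
        using x by (simp add: H_def h_def extend_by_zero_def)
      have id: "e x' * (e x' * (a x' + - a x))
          = (\<Sum>b\<in>Basis. (u b x' + - (\<phi> x \<bullet> b) * e x') * H b x')" for x'
      proof (cases "x' \<in> D \<and> \<phi> x' \<in> U")
        case True
        have i: "?i (\<phi> x') = x'" "?i (\<phi> x) = x"
          using smooth_manifold_chart(4)[OF A ch] True x by auto
        have "a x' - a x = (\<Sum>b\<in>Basis. ((\<phi> x' - \<phi> x) \<bullet> b) * h b (\<phi> x'))"
          using Hadamard[OF K(3) convex x(2) G conjunct2[OF True]] by (simp add: i h_def)
        then show ?thesis
          using True
          by (simp add: e_def u_def H_def extend_by_zero_def sum_distrib_left inner_diff_left)
            (intro sum.cong refl, simp add: algebra_simps)
      qed (auto simp: e_def u_def H_def extend_by_zero_def)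
      have ux: "u b x + - (\<phi> x \<bullet> b) * e x = 0" for b
        using x by (simp add: u_def e_def extend_by_zero_def)
      have s1: "(\<lambda>x'. a x' + - a x) \<in> smooth_funs A"
        by (rule smooth_funs_add[OF A a smooth_funs_const])
      have s2: "(\<lambda>x'. - (\<phi> x \<bullet> b) * e x') \<in> smooth_funs A" for b
        by (rule smooth_funs_mult[OF A smooth_funs_const e])
      have 1: "v (\<lambda>x'. e x' * (e x' * (a x' + - a x))) = e x * e x * v a"
        unfolding tangent_vector_mult[OF v e smooth_funs_mult[OF A e s1]] tangent_vector_mult[OF v e s1]
          tangent_vector_add[OF v a smooth_funs_const] tangent_vector_const[OF v] by simp
      have 2: "v (\<lambda>x'. (u b x' + - (\<phi> x \<bullet> b) * e x') * H b x')
          = (v (u b) + - (\<phi> x \<bullet> b) * v e) * H b x" for b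
        unfolding tangent_vector_mult[OF v smooth_funs_add[OF A u s2] H] ux
          tangent_vector_add[OF v u s2] tangent_vector_scale[OF v e] by simp
      have "e x * e x * v a = v (\<lambda>x'. \<Sum>b\<in>Basis. (u b x' + - (\<phi> x \<bullet> b) * e x') * H b x')"
        unfolding 1[symmetric] id ..
      also have "\<dots> = (\<Sum>b\<in>Basis. (v (u b) + - (\<phi> x \<bullet> b) * v e) * H b x)"
        unfolding 2[symmetric]
        by (rule tangent_vector_sum[OF A v smooth_funs_mult[OF A smooth_funs_add[OF A u s2] H]])
      also have "\<dots> = (\<Sum>b\<in>Basis. v (u b) * Y (b, True) x a + v e * Y (b, False) x a)"
        using x a by (intro sum.cong) (auto simp: Hx Y_def chart_field_def extend_by_zero_def algebra_simps)
      finally show ?thesis unfolding split by simp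
    qed
  qed
  have "e q * e q \<noteq> 0"
    using q R bump_center[of "R / 2" "\<phi> q"] by (simp add: e_def extend_by_zero_def U_def \<beta>_def)
  moreover have "y i \<in> smooth_funs A" for i by (cases i) (simp add: y_def e u)
  ultimately show thesis
    by (intro that[of "\<lambda>x. e x * e x" "Basis \<times> UNIV" y Y] smooth_funs_mult[OF A e e] Y frame)
qed

section \<open>Parallel endomorphism fields along a map\<close>

text \<open>Freeze the coefficients of the frame expansion of \<open>v\<close> at \<open>q\<close>.\<close>
lemma exists_vector_field_through:
  fixes A :: "('m::{t2_space, second_countable_topology}, 'e::euclidean_space) atlas"
  assumes A: "smooth_manifold A" and v: "v \<in> tangent_space A q"
  obtains X where "X \<in> vector_fields A" "X q = v"
proof -
  obtain I :: "('e \<times> bool) set" and \<gamma> y Y where \<gamma>: "\<gamma> q \<noteq> 0"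
    and Y: "\<And>i. i \<in> I \<Longrightarrow> Y i \<in> vector_fields A"
    and fr: "\<And>x v. v \<in> tangent_space A x \<Longrightarrow> \<gamma> x *\<^sub>t v = (\<Sum>i\<in>I. v (y i) *\<^sub>t Y i x)"
    by (rule exists_local_frame[OF A, of q]) blast
  define X where "X = (\<Sum>i\<in>I. (\<lambda>x. (v (y i) / \<gamma> q) *\<^sub>t Y i x))"
  have "X \<in> vector_fields A"
    unfolding X_def by (intro fields_along_sum[OF A] fields_along_tscale[OF A] smooth_funs_const Y)
  moreover have "X q a = v a" for a
  proof -
    have "(\<Sum>i\<in>I. v (y i) * Y i q a) = \<gamma> q * v a"
      using arg_cong[OF fr[OF v], of "\<lambda>w. w a"] by (simp add: fun_sum_apply)
    then show ?thesis
      using \<gamma> by (simp add: X_def fun_sum_apply sum_divide_distrib[symmetric])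
  qed
  ultimately show thesis using that by blast
qed

text \<open>A smooth \<open>(1,1)\<close>-tensor field.\<close>
definition endomorphism_field ::
  "('m, 'e::euclidean_space) atlas \<Rightarrow> ('m \<Rightarrow> 'm tvec \<Rightarrow> 'm tvec) \<Rightarrow> bool" where
  "endomorphism_field B P \<longleftrightarrow>
     (\<forall>q. \<forall>u\<in>tangent_space B q. \<forall>v\<in>tangent_space B q. \<forall>c.
        P q u \<in> tangent_space B q \<and> P q (u + v) = P q u + P q v \<and> P q (c *\<^sub>t u) = c *\<^sub>t P q u) \<and>
     (\<forall>X\<in>vector_fields B. (\<lambda>q. P q (X q)) \<in> vector_fields B)"

lemma endomorphism_fieldD:
  assumes "endomorphism_field B P" "u \<in> tangent_space B q" "v \<in> tangent_space B q"
  shows "P q u \<in> tangent_space B q" "P q (u + v) = P q u + P q v" "P q (c *\<^sub>t u) = c *\<^sub>t P q u"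
  using assms unfolding endomorphism_field_def by blast+

lemma endomorphism_field_sum:
  assumes P: "endomorphism_field B P" and u: "\<And>i. i \<in> I \<Longrightarrow> u i \<in> tangent_space B q"
  shows "P q (\<Sum>i\<in>I. u i) = (\<Sum>i\<in>I. P q (u i))"
proof -
  have "P q (0 *\<^sub>t 0) = 0 *\<^sub>t P q 0"
    using P tangent_space_zero[of B q] unfolding endomorphism_field_def by metis
  then have 0: "P q 0 = 0" by simp
  show ?thesis
    using u
  proof (induction I rule: infinite_finite_induct)
    case (insert i I)
    then have "u i \<in> tangent_space B q" "(\<Sum>i\<in>I. u i) \<in> tangent_space B q"
      by (auto intro: tangent_space_sum)
    then have "P q (u i + (\<Sum>i\<in>I. u i)) = P q (u i) + P q (\<Sum>i\<in>I. u i)"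
      by (rule endomorphism_fieldD(2)[OF P])
    moreover have "P q (\<Sum>i\<in>I. u i) = (\<Sum>i\<in>I. P q (u i))" using insert by blast
    ultimately show ?case by (simp only: sum.insert[OF insert(1,2)])
  qed (simp_all add: 0)
qed

text \<open>Smoothness of \<open>P Y\<close> is known for ambient fields \<open>Y\<close> only. Expanding \<open>\<gamma> V\<close> in the fields of a
  local frame restricted to the submanifold and dividing by \<open>\<gamma>\<close> carries it over to \<open>V\<close>.\<close>
lemma fields_along_endomorphism:
  fixes A :: "('n::{t2_space, second_countable_topology}, 'd::euclidean_space) atlas"
    and B :: "('m::{t2_space, second_countable_topology}, 'e::euclidean_space) atlas"
  assumes A: "smooth_manifold A" and B: "smooth_manifold B" and f: "smooth_map A B f"
    and P: "endomorphism_field B P" and V: "V \<in> fields_along A B f"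
  shows "(\<lambda>p. P (f p) (V p)) \<in> fields_along A B f"
  unfolding fields_along_iff
proof (intro conjI allI ballI)
  have V': "V p \<in> tangent_space B (f p)" for p using V by (simp add: fields_along_iff)
  show "P (f p) (V p) \<in> tangent_space B (f p)" for p
    using P V' unfolding endomorphism_field_def by blast
  fix a assume a: "a \<in> smooth_funs B"
  show "(\<lambda>p. P (f p) (V p) a) \<in> smooth_funs A"
  proof (rule smooth_funs_divide[OF A])
    fix p
    obtain I :: "('e \<times> bool) set" and \<gamma> y Y where \<gamma>: "\<gamma> \<in> smooth_funs B" "\<gamma> (f p) \<noteq> 0"
      and y: "\<And>i. i \<in> I \<Longrightarrow> y i \<in> smooth_funs B" and Y: "\<And>i. i \<in> I \<Longrightarrow> Y i \<in> vector_fields B"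
      and fr: "\<And>x v. v \<in> tangent_space B x \<Longrightarrow> \<gamma> x *\<^sub>t v = (\<Sum>i\<in>I. v (y i) *\<^sub>t Y i x)"
      by (rule exists_local_frame[OF B, of "f p"]) blast
    have eq: "\<gamma> (f x) * P (f x) (V x) a = (\<Sum>i\<in>I. V x (y i) * P (f x) (Y i (f x)) a)" for x
    proof -
      have Yt: "Y i (f x) \<in> tangent_space B (f x)" if "i \<in> I" for i
        using Y[OF that] by (simp add: fields_along_iff)
      have "\<gamma> (f x) *\<^sub>t P (f x) (V x) = P (f x) (\<gamma> (f x) *\<^sub>t V x)"
        by (rule endomorphism_fieldD(3)[OF P V' V', symmetric])
      also have "\<dots> = (\<Sum>i\<in>I. P (f x) (V x (y i) *\<^sub>t Y i (f x)))"
        unfolding fr[OF V'] by (intro endomorphism_field_sum[OF P] tangent_space_tscale Yt)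
      also have "\<dots> = (\<Sum>i\<in>I. V x (y i) *\<^sub>t P (f x) (Y i (f x)))"
        by (intro sum.cong refl endomorphism_fieldD(3)[OF P Yt Yt])
      finally have "(\<gamma> (f x) *\<^sub>t P (f x) (V x)) a = (\<Sum>i\<in>I. V x (y i) *\<^sub>t P (f x) (Y i (f x))) a"
        by (rule fun_cong)
      then show ?thesis by (simp add: fun_sum_apply)
    qed
    have PYa: "(\<lambda>x. P (f x) (Y i (f x)) a) \<in> smooth_funs A" if "i \<in> I" for i
    proof -
      have "(\<lambda>q. P q (Y i q)) \<in> vector_fields B"
        using P Y[OF that] unfolding endomorphism_field_def by blast
      then have "(\<lambda>q. P q (Y i q) a) \<in> smooth_funs B" using a by (simp add: fields_along_iff)
      then show ?thesis by (rule smooth_funs_pullback[OF A B f])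
    qed
    have Vy: "(\<lambda>x. V x (y i)) \<in> smooth_funs A" if "i \<in> I" for i
      using V y[OF that] by (simp add: fields_along_iff)
    have "(\<lambda>x. \<gamma> (f x) * P (f x) (V x) a) \<in> smooth_funs A"
      unfolding eq by (rule smooth_funs_sum[OF A smooth_funs_mult[OF A Vy PYa]])
    then show "\<exists>c\<in>smooth_funs A. c p \<noteq> 0 \<and> (\<lambda>x. c x * P (f x) (V x) a) \<in> smooth_funs A"
      using \<gamma> smooth_funs_pullback[OF A B f \<gamma>(1)] by (intro bexI[of _ "\<lambda>x. \<gamma> (f x)"]) auto
  qed
qed

lemma connection_along_sum:
  assumes A: "smooth_manifold A" and D: "connection_along A B f D" and W: "W \<in> vector_fields A"
    and V: "\<And>i. i \<in> I \<Longrightarrow> V i \<in> fields_along A B f"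
  shows "D W (\<Sum>i\<in>I. V i) = (\<Sum>i\<in>I. D W (V i))"
proof -
  have add: "D W (V + V') = D W V + D W V'"
    if "V \<in> fields_along A B f" "V' \<in> fields_along A B f" for V V'
    using D W that smooth_funs_const[of 0 A] unfolding connection_along_def by blast
  have "D W (0 + 0) = D W 0 + D W 0" by (intro add fields_along_zero)
  then have 0: "D W 0 = 0" by simp
  show ?thesis
    using V
  proof (induction I rule: infinite_finite_induct)
    case (insert i I)
    then have "D W (V i + (\<Sum>i\<in>I. V i)) = D W (V i) + D W (\<Sum>i\<in>I. V i)"
      by (intro add fields_along_sum[OF A]) auto
    moreover have "D W (\<Sum>i\<in>I. V i) = (\<Sum>i\<in>I. D W (V i))" using insert by blast
    ultimately show ?case by (simp only: sum.insert[OF insert(1,2)])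
  qed (simp_all add: 0)
qed

lemma connection_along_leibniz:
  assumes "connection_along A B f D" "W \<in> vector_fields A" "V \<in> fields_along A B f"
    "c \<in> smooth_funs A"
  shows "D W (\<lambda>p. c p *\<^sub>t V p) p = W p c *\<^sub>t V p + c p *\<^sub>t D W V p"
proof -
  have "D W (\<lambda>p. c p *\<^sub>t V p) = (\<lambda>p. W p c *\<^sub>t V p + c p *\<^sub>t D W V p)"
    using assms unfolding connection_along_def by blast
  then show ?thesis by simp
qed

text \<open>Apply \<open>D W\<close> to the expansions \<open>\<gamma> V = \<Sum> c\<^sub>i Y\<^sub>i\<close> and \<open>\<gamma> P V = \<Sum> c\<^sub>i P Y\<^sub>i\<close> along the map,
  whose coefficients agree. On the right the derivatives of the restricted ambient fields are
  given by \<open>nab\<close>, which commutes with \<open>P\<close>, so the second right-hand side is \<open>P\<close> of the first.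
  On the left the derivative of \<open>\<gamma>\<close> contributes the same term, up to \<open>P\<close>, in both, and \<open>\<gamma>\<close> can
  be divided out.\<close>
lemma connection_along_parallel_endomorphism:
  fixes A :: "('n::{t2_space, second_countable_topology}, 'd::euclidean_space) atlas"
    and B :: "('m::{t2_space, second_countable_topology}, 'e::euclidean_space) atlas"
  assumes A: "smooth_manifold A" and B: "smooth_manifold B" and f: "smooth_map A B f"
    and P: "endomorphism_field B P"
    and parallel: "\<And>X Y. X \<in> vector_fields B \<Longrightarrow> Y \<in> vector_fields B \<Longrightarrow>
      nab X (\<lambda>q. P q (Y q)) = (\<lambda>q. P q (nab X Y q))"
    and D: "induced_connection_along A B f nab D"
    and W: "W \<in> vector_fields A" and V: "V \<in> fields_along A B f"
  shows "D W (\<lambda>x. P (f x) (V x)) p = P (f p) (D W V p)"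
proof -
  have conn: "connection_along A B f D"
    and ind: "\<And>X Y. X \<in> vector_fields B \<Longrightarrow> Y \<in> vector_fields B \<Longrightarrow> X (f p) = push B f (W p) \<Longrightarrow>
      D W (\<lambda>x. Y (f x)) p = nab X Y (f p)"
    using D W unfolding induced_connection_along_def by auto
  have closed: "\<And>V. V \<in> fields_along A B f \<Longrightarrow> D W V \<in> fields_along A B f"
    using conn W smooth_funs_const[of 0 A] unfolding connection_along_def by blast
  note fields = fields_along_iff[THEN iffD1, THEN conjunct1, rule_format]
  note PV = fields_along_endomorphism[OF A B f P]
  note P_plus = endomorphism_fieldD(2)[OF P] and P_scale = endomorphism_fieldD(3)[OF P]
  have "push B f (W p) \<in> tangent_space B (f p)"
    using push_tangent_space[OF A B f] W by (simp add: fields_along_iff)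
  then obtain X where X: "X \<in> vector_fields B" "X (f p) = push B f (W p)"
    by (rule exists_vector_field_through[OF B])
  obtain I :: "('e \<times> bool) set" and \<gamma> y Y where \<gamma>: "\<gamma> \<in> smooth_funs B" "\<gamma> (f p) \<noteq> 0"
    and y: "\<And>i. i \<in> I \<Longrightarrow> y i \<in> smooth_funs B" and Y: "\<And>i. i \<in> I \<Longrightarrow> Y i \<in> vector_fields B"
    and fr: "\<And>x v. v \<in> tangent_space B x \<Longrightarrow> \<gamma> x *\<^sub>t v = (\<Sum>i\<in>I. v (y i) *\<^sub>t Y i x)"
    by (rule exists_local_frame[OF B, of "f p"]) blast
  define c where "c = (\<lambda>i x. V x (y i))"
  have c: "c i \<in> smooth_funs A" if "i \<in> I" for i
    using V y[OF that] by (simp add: c_def fields_along_iff)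
  have \<gamma>f: "(\<lambda>x. \<gamma> (f x)) \<in> smooth_funs A" by (rule smooth_funs_pullback[OF A B f \<gamma>(1)])
  have Yf: "(\<lambda>x. Y i (f x)) \<in> fields_along A B f" if "i \<in> I" for i
    by (rule fields_along_restrict[OF A B f Y[OF that]])
  have PY: "(\<lambda>q. P q (Y i q)) \<in> vector_fields B" if "i \<in> I" for i
    using P Y[OF that] unfolding endomorphism_field_def by blast
  \<comment> \<open>To be used for \<open>V\<close> with the fields \<open>Y i\<close> and for \<open>P V\<close> with the fields \<open>P Y i\<close>.\<close>
  have expand: "W p (\<lambda>x. \<gamma> (f x)) *\<^sub>t V' p + \<gamma> (f p) *\<^sub>t D W V' p
      = (\<Sum>i\<in>I. W p (c i) *\<^sub>t Y' i (f p) + c i p *\<^sub>t nab X (Y' i) (f p))"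
    if V': "V' \<in> fields_along A B f" and Y': "\<And>i. i \<in> I \<Longrightarrow> Y' i \<in> vector_fields B"
      and eq: "\<And>x. \<gamma> (f x) *\<^sub>t V' x = (\<Sum>i\<in>I. c i x *\<^sub>t Y' i (f x))" for V' Y'
  proof -
    have Y'f: "(\<lambda>x. Y' i (f x)) \<in> fields_along A B f" if "i \<in> I" for i
      by (rule fields_along_restrict[OF A B f Y'[OF that]])
    have "(\<lambda>x. \<gamma> (f x) *\<^sub>t V' x) = (\<Sum>i\<in>I. (\<lambda>x. c i x *\<^sub>t Y' i (f x)))"
      by (rule ext) (simp add: eq fun_sum_apply)
    then have "D W (\<lambda>x. \<gamma> (f x) *\<^sub>t V' x) p = (\<Sum>i\<in>I. D W (\<lambda>x. c i x *\<^sub>t Y' i (f x))) p"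
      using connection_along_sum[OF A conn W, of I "\<lambda>i x. c i x *\<^sub>t Y' i (f x)"]
        fields_along_tscale[OF A c Y'f] by simp
    also have "\<dots> = (\<Sum>i\<in>I. W p (c i) *\<^sub>t Y' i (f p) + c i p *\<^sub>t nab X (Y' i) (f p))"
      unfolding fun_sum_apply[of _ I p]
      by (intro sum.cong refl)
        (simp add: connection_along_leibniz[OF conn W Y'f c] ind[OF X(1) Y' X(2)])
    finally show ?thesis
      using connection_along_leibniz[OF conn W V' \<gamma>f, of p] by simp
  qed
  have Vp: "V x \<in> tangent_space B (f x)" for x using V by (rule fields)
  have nabt: "nab X (Y i) (f p) \<in> tangent_space B (f p)" if "i \<in> I" for i
    using ind[OF X(1) Y[OF that] X(2)] fields[OF closed[OF Yf[OF that]], of p] by simp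
  have DVp: "D W V p \<in> tangent_space B (f p)" using fields[OF closed[OF V]] .
  have Yt: "Y i x \<in> tangent_space B x" if "i \<in> I" for i x
    using Y[OF that] by (simp add: fields_along_iff)
  have "\<gamma> (f x) *\<^sub>t P (f x) (V x) = (\<Sum>i\<in>I. c i x *\<^sub>t P (f x) (Y i (f x)))" for x
  proof -
    have "\<gamma> (f x) *\<^sub>t P (f x) (V x) = P (f x) (\<gamma> (f x) *\<^sub>t V x)"
      by (rule endomorphism_fieldD(3)[OF P Vp Vp, symmetric])
    also have "\<dots> = (\<Sum>i\<in>I. P (f x) (c i x *\<^sub>t Y i (f x)))"
      unfolding fr[OF Vp] c_def by (intro endomorphism_field_sum[OF P] tangent_space_tscale Yt)
    also have "\<dots> = (\<Sum>i\<in>I. c i x *\<^sub>t P (f x) (Y i (f x)))"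
      by (intro sum.cong refl endomorphism_fieldD(3)[OF P Yt Yt])
    finally show ?thesis .
  qed
  from expand[OF PV[OF V] PY this]
  have "W p (\<lambda>x. \<gamma> (f x)) *\<^sub>t P (f p) (V p) + \<gamma> (f p) *\<^sub>t D W (\<lambda>x. P (f x) (V x)) p
      = (\<Sum>i\<in>I. W p (c i) *\<^sub>t P (f p) (Y i (f p)) + c i p *\<^sub>t P (f p) (nab X (Y i) (f p)))"
    using parallel[OF X(1) Y] by simp
  also have "\<dots> = (\<Sum>i\<in>I. P (f p) (W p (c i) *\<^sub>t Y i (f p) + c i p *\<^sub>t nab X (Y i) (f p)))"
    using Yt nabt
    by (intro sum.cong refl)
      (simp add: P_plus P_scale[where v = 0] tangent_space_tscale tangent_space_zero)
  also have "\<dots> = P (f p) (\<Sum>i\<in>I. W p (c i) *\<^sub>t Y i (f p) + c i p *\<^sub>t nab X (Y i) (f p))"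
    by (intro endomorphism_field_sum[OF P, symmetric] tangent_space_plus tangent_space_tscale Yt nabt)
  also have "\<dots> = P (f p) (W p (\<lambda>x. \<gamma> (f x)) *\<^sub>t V p + \<gamma> (f p) *\<^sub>t D W V p)"
    using expand[OF V Y] fr[OF Vp] by (simp add: c_def)
  also have "\<dots> = W p (\<lambda>x. \<gamma> (f x)) *\<^sub>t P (f p) (V p) + \<gamma> (f p) *\<^sub>t P (f p) (D W V p)"
    using Vp DVp by (simp add: P_plus P_scale[where v = 0] tangent_space_tscale tangent_space_zero)
  finally have "\<gamma> (f p) *\<^sub>t D W (\<lambda>x. P (f x) (V x)) p = \<gamma> (f p) *\<^sub>t P (f p) (D W V p)" by simp
  then show ?thesis using \<gamma>(2) by (simp add: fun_eq_iff)
qed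

section \<open>Nondegenerate subspaces\<close>

text \<open>Tangent vectors are functions, but the arguments below treat them as abstract vectors.
  Simplification must then leave sums and multiples intact: \<open>g (u + v) w\<close> has to keep the form to
  which the bilinearity of \<open>g\<close> applies.\<close>
declare plus_fun_apply [simp del] minus_apply [simp del] uminus_apply [simp del]
  zero_fun_apply [simp del] tscale_apply [simp del]
lemmas pointwise_apply = plus_fun_apply minus_apply uminus_apply zero_fun_apply tscale_apply

definition tvec_subspace :: "'m tvec set \<Rightarrow> bool" where
  "tvec_subspace E \<longleftrightarrow> 0 \<in> E \<and> (\<forall>u\<in>E. \<forall>v\<in>E. \<forall>c. u + v \<in> E \<and> c *\<^sub>t u \<in> E)"

lemma tvec_subspaceD:
  assumes E: "tvec_subspace E"
  shows "u \<in> E \<Longrightarrow> v \<in> E \<Longrightarrow> u + v \<in> E" "u \<in> E \<Longrightarrow> c *\<^sub>t u \<in> E"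
    "u \<in> E \<Longrightarrow> v \<in> E \<Longrightarrow> u - v \<in> E" "u \<in> E \<Longrightarrow> - u \<in> E"
proof -
  show plus: "u + v \<in> E" if "u \<in> E" "v \<in> E" for u v
    using E that unfolding tvec_subspace_def by blast
  show scale: "c *\<^sub>t u \<in> E" if "u \<in> E" for u c
    using E that unfolding tvec_subspace_def by blast
  show "- u \<in> E" if "u \<in> E" unfolding minus_tscale by (rule scale[OF that])
  show "u - v \<in> E" if "u \<in> E" "v \<in> E"
    using plus[OF that(1) scale[OF that(2), of "-1"]] unfolding minus_tscale[symmetric] by simp
qed

lemma tvec_subspace_sum:
  assumes "tvec_subspace E" "\<And>i. i \<in> I \<Longrightarrow> u i \<in> E"
  shows "(\<Sum>i\<in>I. u i) \<in> E"
  using assms(2)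
proof (induction I rule: infinite_finite_induct)
  case (insert i I)
  then show ?case
    unfolding sum.insert[OF insert(1,2)] by (intro tvec_subspaceD(1)[OF assms(1)]) auto
qed (use assms(1) in \<open>simp_all add: tvec_subspace_def\<close>)

lemma tvec_subspace_range:
  fixes k :: nat
  shows
  "tvec_subspace (range (\<lambda>c. \<Sum>i<k. c i *\<^sub>t e i))" (is "tvec_subspace (range ?s)")
  unfolding tvec_subspace_def
proof (intro conjI ballI allI)
  have "?s (\<lambda>i. 0) = 0" by simp
  moreover have "?s (\<lambda>i. 0) \<in> range ?s" by (rule rangeI)
  ultimately show "0 \<in> range ?s" by (simp only:)
  fix u v a assume "u \<in> range ?s" "v \<in> range ?s"
  then obtain c d where c: "u = ?s c" "v = ?s d" by blast
  have "?s c + ?s d = ?s (\<lambda>i. c i + d i)"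
    by (rule ext) (simp add: fun_sum_apply pointwise_apply sum.distrib[symmetric] algebra_simps)
  then show "u + v \<in> range ?s" unfolding c by (rule range_eqI[where x = "\<lambda>i. c i + d i"])
  have "a *\<^sub>t ?s c = ?s (\<lambda>i. a * c i)"
    by (rule ext) (simp add: fun_sum_apply pointwise_apply sum_distrib_left algebra_simps)
  then show "a *\<^sub>t u \<in> range ?s" unfolding c by (rule range_eqI[where x = "\<lambda>i. a * c i"])
qed

lemma tvec_subspace_tangent_space: "tvec_subspace (tangent_space A p)"
  by (simp add: tvec_subspace_def tangent_space_zero tangent_space_plus tangent_space_tscale)

definition linear_on_subspace :: "'m tvec set \<Rightarrow> ('m tvec \<Rightarrow> real) \<Rightarrow> bool" where
  "linear_on_subspace E l \<longleftrightarrow>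
     (\<forall>u\<in>E. \<forall>v\<in>E. \<forall>c. l (u + v) = l u + l v \<and> l (c *\<^sub>t u) = c * l u)"

lemma linear_on_subspaceD:
  assumes E: "tvec_subspace E" and l: "linear_on_subspace E l"
  shows "u \<in> E \<Longrightarrow> v \<in> E \<Longrightarrow> l (u + v) = l u + l v"
    "u \<in> E \<Longrightarrow> l (c *\<^sub>t u) = c * l u"
    "l 0 = 0"
    "u \<in> E \<Longrightarrow> v \<in> E \<Longrightarrow> l (u - v) = l u - l v"
    "(\<And>i. i \<in> I \<Longrightarrow> w i \<in> E) \<Longrightarrow> l (\<Sum>i\<in>I. d i *\<^sub>t w i) = (\<Sum>i\<in>I. d i * l (w i))"
proof -
  have add: "l (u + v) = l u + l v" if "u \<in> E" "v \<in> E" for u v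
    using l that unfolding linear_on_subspace_def by blast
  have scale: "l (c *\<^sub>t u) = c * l u" if "u \<in> E" for u c
    using l that unfolding linear_on_subspace_def by blast
  show "u \<in> E \<Longrightarrow> v \<in> E \<Longrightarrow> l (u + v) = l u + l v" "u \<in> E \<Longrightarrow> l (c *\<^sub>t u) = c * l u"
    by (rule add scale; assumption)+
  have z: "0 \<in> E" using E unfolding tvec_subspace_def by blast
  show 0: "l 0 = 0" using scale[OF z, of 0] by simp
  show "l (u - v) = l u - l v" if "u \<in> E" "v \<in> E"
  proof -
    have "u - v = u + (-1) *\<^sub>t v" unfolding minus_tscale[symmetric] by simp
    then show ?thesis
      using add[OF that(1) tvec_subspaceD(2)[OF E that(2)], of "-1"] scale[OF that(2), of "-1"]
      by (simp only:)
  qed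
  show "l (\<Sum>i\<in>I. d i *\<^sub>t w i) = (\<Sum>i\<in>I. d i * l (w i))" if "\<And>i. i \<in> I \<Longrightarrow> w i \<in> E"
    using that
  proof (induction I rule: infinite_finite_induct)
    case (insert i I)
    have "l (d i *\<^sub>t w i + (\<Sum>i\<in>I. d i *\<^sub>t w i)) = l (d i *\<^sub>t w i) + l (\<Sum>i\<in>I. d i *\<^sub>t w i)"
      using insert.prems by (intro add tvec_subspace_sum[OF E] tvec_subspaceD(2)[OF E]) auto
    moreover have "l (\<Sum>i\<in>I. d i *\<^sub>t w i) = (\<Sum>i\<in>I. d i * l (w i))" using insert by blast
    moreover have "l (d i *\<^sub>t w i) = d i * l (w i)" using insert.prems by (intro scale) auto
    ultimately show ?case by (simp only: sum.insert[OF insert(1,2)])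
  qed (simp_all add: 0)
qed

text \<open>Linearly independent functionals have a dual family. Given one for the first \<open>k\<close>, some vector
  \<open>x\<close> killed by these is not killed by \<open>l k\<close>: otherwise, subtracting from any vector its
  dual expansion shows that \<open>l k\<close> is a combination of the others. Normalised, \<open>x\<close> becomes the
  last member and serves to correct the others.\<close>
lemma exists_dual_family:
  fixes k :: nat
  assumes E: "tvec_subspace E" and l: "\<And>i. i < k \<Longrightarrow> linear_on_subspace E (l i)"
    and indep: "\<And>d. (\<And>x. x \<in> E \<Longrightarrow> (\<Sum>i<k. d i * l i x) = 0) \<Longrightarrow> (\<forall>i<k. d i = 0)"
  shows "\<exists>u. \<forall>i<k. u i \<in> E \<and> (\<forall>j<k. l j (u i) = (if i = j then 1 else 0))"
  using l indep
proof (induction k)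
  case (Suc k)
  note lin = linear_on_subspaceD[OF E Suc.prems(1)]
  have indep_k: "\<forall>i<k. d i = 0" if "\<And>x. x \<in> E \<Longrightarrow> (\<Sum>i<k. d i * l i x) = 0" for d
  proof -
    have "\<forall>i<Suc k. (d(k := 0)) i = 0" by (rule Suc.prems(2)) (use that in simp)
    then show ?thesis by (metis fun_upd_apply less_SucI less_irrefl)
  qed
  obtain u where u: "\<And>i. i < k \<Longrightarrow> u i \<in> E"
    "\<And>i j. i < k \<Longrightarrow> j < k \<Longrightarrow> l j (u i) = (if i = j then 1 else 0)"
  proof -
    have "\<exists>u. \<forall>i<k. u i \<in> E \<and> (\<forall>j<k. l j (u i) = (if i = j then 1 else 0))"
      by (rule Suc.IH) (use Suc.prems(1) indep_k in simp_all)
    then show thesis using that by blast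
  qed
  have "\<exists>x\<in>E. (\<forall>j<k. l j x = 0) \<and> l k x \<noteq> 0"
  proof (rule ccontr)
    assume *: "\<not> ?thesis"
    \<comment> \<open>The relation that expresses \<open>l k\<close> by the other functionals.\<close>
    let ?d = "\<lambda>i. if i = k then -1 else l k (u i)"
    have "(\<Sum>i<Suc k. ?d i * l i x) = 0" if x: "x \<in> E" for x
    proof -
      let ?s = "\<Sum>i<k. l i x *\<^sub>t u i"
      have s: "?s \<in> E" using u(1) by (intro tvec_subspace_sum[OF E] tvec_subspaceD(2)[OF E]) auto
      have ls: "l j ?s = (\<Sum>i<k. l i x * l j (u i))" if "j < Suc k" for j
        using lin(5)[OF that, where I = "{..<k}" and w = u and d = "\<lambda>i. l i x"] u(1) by simp
      have "l j (x - ?s) = 0" if "j < k" for j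
      proof -
        have "(\<Sum>i<k. l i x * l j (u i)) = (\<Sum>i<k. if i = j then l i x else 0)"
          using u(2) that by (intro sum.cong) auto
        then have "l j ?s = l j x" using that ls[of j] by simp
        moreover have "l j (x - ?s) = l j x - l j ?s" by (rule lin(4)[OF _ x s]) (use that in simp)
        ultimately show ?thesis by linarith
      qed
      then have "l k (x - ?s) = 0" using * tvec_subspaceD(3)[OF E x s] by blast
      moreover have "l k (x - ?s) = l k x - l k ?s" by (rule lin(4)[OF _ x s]) simp
      ultimately have "l k x = (\<Sum>i<k. l i x * l k (u i))" using ls[of k] by linarith
      moreover have "(\<Sum>i<k. ?d i * l i x) = (\<Sum>i<k. l i x * l k (u i))"
        by (intro sum.cong) auto
      ultimately show ?thesis by simp
    qed
    from Suc.prems(2)[of ?d, OF this] show False by auto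
  qed
  then obtain x where x: "x \<in> E" "\<And>j. j < k \<Longrightarrow> l j x = 0" "l k x \<noteq> 0" by blast
  define w where "w = (1 / l k x) *\<^sub>t x"
  have w: "w \<in> E" unfolding w_def by (rule tvec_subspaceD(2)[OF E x(1)])
  have lw: "l j w = (if j = k then 1 else 0)" if "j < Suc k" for j
    using lin(2)[OF that x(1)] that x(2,3) by (auto simp: w_def less_Suc_eq)
  define u' where "u' = (\<lambda>i. if i = k then w else u i - l k (u i) *\<^sub>t w)"
  have "u' i \<in> E" if "i < Suc k" for i
    using that u(1) w by (auto simp: u'_def less_Suc_eq intro!: tvec_subspaceD(2,3)[OF E])
  moreover have "l j (u' i) = (if i = j then 1 else 0)" if "i < Suc k" "j < Suc k" for i j
  proof (cases "i = k")
    case False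
    then have "l j (u' i) = l j (u i) - l k (u i) * l j w"
      using that u(1)[of i] lin(2)[OF that(2) w] lin(4)[OF that(2) _ tvec_subspaceD(2)[OF E w]]
      by (simp add: u'_def)
    then show ?thesis using False that u(2)[of i j] lw[of j] by auto
  qed (use lw that in \<open>auto simp: u'_def\<close>)
  ultimately show ?case by blast
qed simp

text \<open>Orthogonal projection to a nondegenerate subspace of finite dimension. Nondegeneracy makes the
  functionals \<open>b (e i)\<close> independent on \<open>E\<close>, and in terms of a dual family \<open>u i\<close> the projection of
  \<open>v\<close> is \<open>\<Sum> b(v, e\<^sub>i) u\<^sub>i\<close>.\<close>
lemma nondegenerate_projection:
  fixes k :: nat
  assumes T: "tvec_subspace T" and e: "\<And>i. i < k \<Longrightarrow> e i \<in> T"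
    and E: "E = range (\<lambda>c. \<Sum>i<k. c i *\<^sub>t e i)"
    and indep: "\<And>c. (\<Sum>i<k. c i *\<^sub>t e i) = 0 \<Longrightarrow> (\<forall>i<k. c i = 0)"
    and b: "\<And>u. u \<in> T \<Longrightarrow> linear_on_subspace T (b u)"
      "\<And>u v. u \<in> T \<Longrightarrow> v \<in> T \<Longrightarrow> b u v = b v u"
    and nd: "nondegenerate_on b E" and v: "v \<in> T"
  shows "\<exists>u\<in>E. \<forall>w\<in>E. b v w = b u w"
proof -

  have subE: "tvec_subspace E" unfolding E by (rule tvec_subspace_range)
  have comb: "(\<Sum>i<k. c i *\<^sub>t e i) \<in> T" for c
    using e by (intro tvec_subspace_sum[OF T] tvec_subspaceD(2)[OF T]) auto
  have ET: "E \<subseteq> T" using comb unfolding E by blast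
  have comb_right: "b w (\<Sum>i<k. c i *\<^sub>t e i) = (\<Sum>i<k. c i * b w (e i))" if "w \<in> T" for w c
    using linear_on_subspaceD(5)[OF T b(1)[OF that], where I = "{..<k}" and w = e and d = c] e by simp
  have comb_left: "b (\<Sum>i<k. c i *\<^sub>t e i) w = (\<Sum>i<k. c i * b (e i) w)" if "w \<in> T" for w c
    unfolding b(2)[OF comb that] comb_right[OF that] using b(2)[OF that e] by (intro sum.cong) auto
  have l: "linear_on_subspace E (b (e i))" if "i < k" for i
    using b(1)[OF e[OF that]] ET unfolding linear_on_subspace_def by blast
  have indep_l: "\<forall>i<k. d i = 0" if "\<And>x. x \<in> E \<Longrightarrow> (\<Sum>i<k. d i * b (e i) x) = 0" for d
  proof (rule indep)
    have "(\<Sum>i<k. d i *\<^sub>t e i) \<in> E" unfolding E by blast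
    moreover have "\<forall>x\<in>E. b (\<Sum>i<k. d i *\<^sub>t e i) x = 0" using that comb_left ET by auto
    ultimately show "(\<Sum>i<k. d i *\<^sub>t e i) = 0" using nd unfolding nondegenerate_on_def by blast
  qed
  obtain u where u: "\<And>i. i < k \<Longrightarrow> u i \<in> E"
    "\<And>i j. i < k \<Longrightarrow> j < k \<Longrightarrow> b (e j) (u i) = (if i = j then 1 else 0)"
  proof -
    have "\<exists>u. \<forall>i<k. u i \<in> E \<and> (\<forall>j<k. b (e j) (u i) = (if i = j then 1 else 0))"
      by (rule exists_dual_family[OF subE l indep_l])
    then show thesis using that by blast
  qed
  define s where "s = (\<Sum>i<k. b v (e i) *\<^sub>t u i)"
  have s: "s \<in> E"
    unfolding s_def using u(1) by (intro tvec_subspace_sum[OF subE] tvec_subspaceD(2)[OF subE]) auto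
  have "b (e j) s = b v (e j)" if "j < k" for j
  proof -
    have "b (e j) s = (\<Sum>i<k. b v (e i) * b (e j) (u i))"
      unfolding s_def
      using linear_on_subspaceD(5)[OF subE l[OF that], where I = "{..<k}" and w = u] u(1) by simp
    also have "\<dots> = (\<Sum>i<k. if i = j then b v (e i) else 0)"
      using u(2) that by (intro sum.cong) auto
    finally show ?thesis using that by simp
  qed
  then have "b v (e j) = b s (e j)" if "j < k" for j
    using b(2)[of s "e j"] s ET e that by auto
  then have "b v w = b s w" if "w \<in> E" for w
    using that comb_right v s ET unfolding E by auto
  then show ?thesis using s by blast
qed

section \<open>The decomposition of the ambient tangent spaces\<close>

lemma push_sum: "push B f (\<Sum>i\<in>I. c i *\<^sub>t u i) = (\<Sum>i\<in>I. c i *\<^sub>t push B f (u i))"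
  by (auto simp: push_def fun_eq_iff fun_sum_apply pointwise_apply)

lemma metric_linear:
  assumes "semi_riemannian_metric B g"
  shows "u \<in> tangent_space B q \<Longrightarrow> linear_on_subspace (tangent_space B q) (g q u)"
    "u \<in> tangent_space B q \<Longrightarrow> v \<in> tangent_space B q \<Longrightarrow> g q u v = g q v u"
proof -
  show sym: "g q u v = g q v u" if "u \<in> tangent_space B q" "v \<in> tangent_space B q" for u v
    using assms that unfolding semi_riemannian_metric_def by blast
  show "linear_on_subspace (tangent_space B q) (g q u)" if u: "u \<in> tangent_space B q"
    unfolding linear_on_subspace_def
  proof (intro ballI allI conjI)
    fix v w c assume v: "v \<in> tangent_space B q" "w \<in> tangent_space B q"
    have "g q (v + w) u = g q v u + g q w u" "g q (c *\<^sub>t v) u = c * g q v u"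
      using assms u v unfolding semi_riemannian_metric_def by blast+
    then show "g q u (v + w) = g q u v + g q u w" "g q u (c *\<^sub>t v) = c * g q u v"
      using sym[OF u] v by (simp_all add: tangent_space_plus tangent_space_tscale)
  qed
qed

text \<open>What the decomposition of the ambient tangent spaces along a lightlike submanifold depends on.\<close>
locale lightlike_submanifold_with_bundles =
  fixes A :: "('n::{t2_space, second_countable_topology}, 'd::euclidean_space) atlas"
    and B :: "('m::{t2_space, second_countable_topology}, 'e::euclidean_space) atlas"
    and f :: "'n \<Rightarrow> 'm"
    and g :: "'m metric"
    and r :: nat
    and S :: "'n \<Rightarrow> 'n tvec set"
    and St ltr :: "'n \<Rightarrow> 'm tvec set"
  assumes manifold_B: "smooth_manifold B" and metric: "semi_riemannian_metric B g"
    and lightlike: "lightlike_submanifold A B f g r"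
    and screen: "screen_distribution A B f g S"
    and screen_transversal: "screen_transversal_bundle A B f g St"
    and lightlike_transversal: "lightlike_transversal_bundle A B f g r S St ltr"
begin

lemma manifold_A: "smooth_manifold A" and smooth_f: "smooth_map A B f"
  and push_inj: "inj_on (push B f) (tangent_space A p)"
  using lightlike unfolding lightlike_submanifold_def immersion_def by simp_all

abbreviation T where
  "T p \<equiv> tangent_space B (f p)"
abbreviation G where
  "G p \<equiv> g (f p)"

lemma push_T: "u \<in> tangent_space A p \<Longrightarrow> push B f u \<in> T p"
  by (rule push_tangent_space[OF manifold_A manifold_B smooth_f])

lemma push_eq_0_iff: "u \<in> tangent_space A p \<Longrightarrow> push B f u = 0 \<longleftrightarrow> u = 0"
  using inj_onD[OF push_inj[of p], of u 0] tangent_space_zero[of A p] by auto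

lemma Rad_tangent: "w \<in> Rad A B f g p \<Longrightarrow> w \<in> tangent_space A p"
  by (simp add: Rad_def)

lemma G_sym: "u \<in> T p \<Longrightarrow> v \<in> T p \<Longrightarrow> G p u v = G p v u"
  by (rule metric_linear(2)[OF metric])

lemmas G_linear = linear_on_subspaceD[OF tvec_subspace_tangent_space metric_linear(1)[OF metric]]

lemma G_left:
  assumes "v \<in> T p"
  shows "u \<in> T p \<Longrightarrow> w \<in> T p \<Longrightarrow> G p (u + w) v = G p u v + G p w v"
    "u \<in> T p \<Longrightarrow> w \<in> T p \<Longrightarrow> G p (u - w) v = G p u v - G p w v"
    "u \<in> T p \<Longrightarrow> G p (c *\<^sub>t u) v = c * G p u v"
proof -
  note sym = G_sym[OF _ assms]
  show "G p (u + w) v = G p u v + G p w v" if "u \<in> T p" "w \<in> T p"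
    unfolding sym[OF that(1)] sym[OF that(2)] sym[OF tangent_space_plus[OF that]]
    by (rule G_linear(1)[OF assms that])
  show "G p (u - w) v = G p u v - G p w v" if "u \<in> T p" "w \<in> T p"
    unfolding sym[OF that(1)] sym[OF that(2)] sym[OF tangent_space_diff[OF that]]
    by (rule G_linear(4)[OF assms that])
  show "G p (c *\<^sub>t u) v = c * G p u v" if "u \<in> T p"
    unfolding sym[OF that] sym[OF tangent_space_tscale[OF that]]
    by (rule G_linear(2)[OF assms that])
qed

lemma G_left_sum:
  assumes v: "v \<in> T p" and w: "\<And>i. i \<in> I \<Longrightarrow> w i \<in> T p"
  shows "G p (\<Sum>i\<in>I. c i *\<^sub>t w i) v = (\<Sum>i\<in>I. c i * G p (w i) v)"
proof -
  have "(\<Sum>i\<in>I. c i *\<^sub>t w i) \<in> T p" using w by (intro tangent_space_sum tangent_space_tscale)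
  then have "G p (\<Sum>i\<in>I. c i *\<^sub>t w i) v = G p v (\<Sum>i\<in>I. c i *\<^sub>t w i)" using v by (rule G_sym)
  also have "\<dots> = (\<Sum>i\<in>I. c i * G p v (w i))" by (rule G_linear(5)[OF v w])
  also have "\<dots> = (\<Sum>i\<in>I. c i * G p (w i) v)"
    by (intro sum.cong refl arg_cong2[where f = "(*)"] G_sym[OF v w])
  finally show ?thesis .
qed

lemma Rad_push_orthogonal:
  "w \<in> Rad A B f g p \<Longrightarrow> u \<in> tangent_space A p \<Longrightarrow> G p (push B f w) (push B f u) = 0"
  by (simp add: Rad_def normal_space_def)

lemma tangent_split:
  "u \<in> tangent_space A p \<longleftrightarrow> (\<exists>w\<in>Rad A B f g p. \<exists>s\<in>S p. u = w + s)"
  "Rad A B f g p \<inter> S p = {0}"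
proof -
  have "direct_sum (tangent_space A p) (Rad A B f g p) (S p)"
    using screen unfolding screen_distribution_def by simp
  then show "u \<in> tangent_space A p \<longleftrightarrow> (\<exists>w\<in>Rad A B f g p. \<exists>s\<in>S p. u = w + s)"
    "Rad A B f g p \<inter> S p = {0}"
    unfolding direct_sum_def by auto
qed

lemma normal_split:
  "v \<in> normal_space A B f g p \<longleftrightarrow> (\<exists>w\<in>Rad A B f g p. \<exists>s\<in>St p. v = push B f w + s)"
proof -
  have "direct_sum (normal_space A B f g p) (push B f ` Rad A B f g p) (St p)"
    using screen_transversal unfolding screen_transversal_bundle_def by simp
  then show ?thesis unfolding direct_sum_def by auto
qed

lemma St_normal: "s \<in> St p \<Longrightarrow> s \<in> normal_space A B f g p"
proof -
  assume s: "s \<in> St p"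
  have "0 \<in> Rad A B f g p" using tangent_split(2) by blast
  then show ?thesis unfolding normal_split using s by (intro bexI[of _ 0] bexI[of _ s]) simp_all
qed

lemma St_T: "s \<in> St p \<Longrightarrow> s \<in> T p"
  and St_push_orthogonal: "s \<in> St p \<Longrightarrow> u \<in> tangent_space A p \<Longrightarrow> G p s (push B f u) = 0"
  using St_normal by (auto simp: normal_space_def)

lemma S_tangent: "s \<in> S p \<Longrightarrow> s \<in> tangent_space A p"
proof -
  assume s: "s \<in> S p"
  have "0 \<in> Rad A B f g p" using tangent_split(2) by blast
  then show ?thesis unfolding tangent_split(1) using s by (intro bexI[of _ 0] bexI[of _ s]) simp_all
qed

lemma S_frame:
  obtains k :: nat and e where "\<And>i. i < k \<Longrightarrow> e i \<in> tangent_space A p"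
    "S p = range (\<lambda>c. \<Sum>i<k. c i *\<^sub>t e i)"
    "\<forall>c. (\<Sum>i<k. c i *\<^sub>t e i) = 0 \<longrightarrow> (\<forall>i<k. c i = 0)"
proof -
  obtain k where "smooth_distribution A S k" using screen unfolding screen_distribution_def by blast
  then obtain Q e where "p \<in> Q" "smooth_frame_on A A (\<lambda>p. p) Q S k e"
    unfolding smooth_subbundle_def by blast
  then show thesis
    by (intro that[of k "\<lambda>i. e i p"]) (auto simp: smooth_frame_on_def fields_along_on_def)
qed

lemma St_frame:
  obtains k :: nat and e where "\<And>i. i < k \<Longrightarrow> e i \<in> T p"
    "St p = range (\<lambda>c. \<Sum>i<k. c i *\<^sub>t e i)"
    "\<forall>c. (\<Sum>i<k. c i *\<^sub>t e i) = 0 \<longrightarrow> (\<forall>i<k. c i = 0)"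
proof -
  obtain k where "smooth_subbundle A B f St k"
    using screen_transversal unfolding screen_transversal_bundle_def by blast
  then obtain Q e where "p \<in> Q" "smooth_frame_on A B f Q St k e"
    unfolding smooth_subbundle_def by blast
  then show thesis
    by (intro that[of k "\<lambda>i. e i p"]) (auto simp: smooth_frame_on_def fields_along_on_def)
qed

lemma null_frame:
  obtains \<xi> N where "\<And>i. i < r \<Longrightarrow> \<xi> i \<in> Rad A B f g p" "\<And>i. i < r \<Longrightarrow> N i \<in> ltr p"
    "\<And>i. i < r \<Longrightarrow> N i \<in> T p"
    "Rad A B f g p = range (\<lambda>c. \<Sum>i<r. c i *\<^sub>t \<xi> i)" "ltr p = range (\<lambda>c. \<Sum>i<r. c i *\<^sub>t N i)"
    "\<And>i j. i < r \<Longrightarrow> j < r \<Longrightarrow> G p (N i) (push B f (\<xi> j)) = (if i = j then 1 else 0)"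
    "\<And>i j. i < r \<Longrightarrow> j < r \<Longrightarrow> G p (N i) (N j) = 0"
    "\<And>i u. i < r \<Longrightarrow> u \<in> S p \<Longrightarrow> G p (N i) (push B f u) = 0"
    "\<And>i u. i < r \<Longrightarrow> u \<in> St p \<Longrightarrow> G p (N i) u = 0"
proof -
  obtain Q \<xi> N where p: "p \<in> Q" and \<xi>: "smooth_frame_on A A (\<lambda>x. x) Q (Rad A B f g) r \<xi>"
    and N: "smooth_frame_on A B f Q ltr r N"
    and o: "\<forall>x\<in>Q. \<forall>i<r.
           (\<forall>j<r. g (f x) (N i x) (push B f (\<xi> j x)) = (if i = j then 1 else 0)) \<and>
           (\<forall>j<r. g (f x) (N i x) (N j x) = 0) \<and>
           (\<forall>u\<in>S x. g (f x) (N i x) (push B f u) = 0) \<and>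
           (\<forall>u\<in>St x. g (f x) (N i x) u = 0)"
    using lightlike_transversal[unfolded lightlike_transversal_bundle_def, rule_format, of p] by blast
  have R: "Rad A B f g p = range (\<lambda>c. \<Sum>i<r. c i *\<^sub>t \<xi> i p)"
    and L: "ltr p = range (\<lambda>c. \<Sum>i<r. c i *\<^sub>t N i p)"
    and NT: "\<And>i. i < r \<Longrightarrow> N i p \<in> T p"
    using \<xi> N p by (auto simp: smooth_frame_on_def fields_along_on_def)
  have single: "e i \<in> range (\<lambda>c. \<Sum>i<r. c i *\<^sub>t e i)" if "i < r" for i and e :: "nat \<Rightarrow> 'x tvec"
  proof -
    have "(\<Sum>j<r. (if j = i then 1 else 0) *\<^sub>t e j) = (\<Sum>j<r. if j = i then e j else 0)"
      by (intro sum.cong) (auto simp: fun_eq_iff pointwise_apply)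
    also have "\<dots> = e i" using that by simp
    finally show ?thesis by (intro range_eqI[of _ _ "\<lambda>j. if j = i then 1 else 0"]) simp
  qed
  have "\<And>i. i < r \<Longrightarrow> \<xi> i p \<in> Rad A B f g p" "\<And>i. i < r \<Longrightarrow> N i p \<in> ltr p"
    unfolding R L by (rule single; assumption)+
  then show thesis
    using o p by (intro that[of "\<lambda>i. \<xi> i p" "\<lambda>i. N i p", OF _ _ NT R L]) blast+
qed

lemma ltr_T: "l \<in> ltr p \<Longrightarrow> l \<in> T p"
  and ltr_S_orthogonal: "l \<in> ltr p \<Longrightarrow> u \<in> S p \<Longrightarrow> G p l (push B f u) = 0"
  and ltr_St_orthogonal: "l \<in> ltr p \<Longrightarrow> s \<in> St p \<Longrightarrow> G p l s = 0"
proof -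
  assume l: "l \<in> ltr p"
  obtain N :: "nat \<Rightarrow> 'm tvec" where N: "\<And>i. i < r \<Longrightarrow> N i \<in> T p"
      "ltr p = range (\<lambda>c. \<Sum>i<r. c i *\<^sub>t N i)"
      "\<And>i u. i < r \<Longrightarrow> u \<in> S p \<Longrightarrow> G p (N i) (push B f u) = 0"
      "\<And>i u. i < r \<Longrightarrow> u \<in> St p \<Longrightarrow> G p (N i) u = 0"
    by (rule null_frame[of p]) blast
  then obtain c where c: "l = (\<Sum>i<r. c i *\<^sub>t N i)" using l by blast
  show "l \<in> T p" unfolding c using N(1) by (intro tangent_space_sum tangent_space_tscale) auto
  show "G p l (push B f u) = 0" if "u \<in> S p"
    unfolding c using G_left_sum[OF push_T[OF S_tangent[OF that]], of "{..<r}" N c] N(1) N(3)[OF _ that]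
    by simp
  show "G p l s = 0" if "s \<in> St p"
    unfolding c using G_left_sum[OF St_T[OF that], of "{..<r}" N c] N(1) N(4)[OF _ that] by simp
qed

lemma S_projection:
  assumes v: "v \<in> T p"
  shows "\<exists>s\<in>S p. \<forall>u\<in>S p. G p v (push B f u) = G p (push B f s) (push B f u)"
proof -
  obtain k :: nat and e where e: "\<And>i. i < k \<Longrightarrow> e i \<in> tangent_space A p"
    "S p = range (\<lambda>c. \<Sum>i<k. c i *\<^sub>t e i)"
    "\<forall>c. (\<Sum>i<k. c i *\<^sub>t e i) = 0 \<longrightarrow> (\<forall>i<k. c i = 0)" by (rule S_frame[of p]) blast
  note ps = push_sum[where I = "{..<k}" and u = e]
  have "\<exists>s\<in>push B f ` S p. \<forall>w\<in>push B f ` S p. G p v w = G p s w"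
  proof (rule nondegenerate_projection[OF tvec_subspace_tangent_space, where e = "\<lambda>i. push B f (e i)" and k = k])
    show "push B f ` S p = range (\<lambda>c. \<Sum>i<k. c i *\<^sub>t push B f (e i))"
      unfolding e(2) image_image ps ..
    show "\<forall>i<k. c i = 0" if "(\<Sum>i<k. c i *\<^sub>t push B f (e i)) = 0" for c
    proof (rule e(3)[THEN spec, THEN mp])
      have "(\<Sum>i<k. c i *\<^sub>t e i) \<in> tangent_space A p"
        using e(1) by (intro tangent_space_sum tangent_space_tscale) auto
      then show "(\<Sum>i<k. c i *\<^sub>t e i) = 0"
        by (rule push_eq_0_iff[THEN iffD1]) (simp only: ps that)
    qed
    show "nondegenerate_on (G p) (push B f ` S p)"
      using screen unfolding screen_distribution_def by blast
    show "push B f (e i) \<in> T p" if "i < k" for i by (rule push_T[OF e(1)[OF that]])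
  qed (rule metric_linear[OF metric] v; assumption)+
  then show ?thesis by blast
qed

lemma St_projection:
  assumes v: "v \<in> T p"
  shows "\<exists>s\<in>St p. \<forall>w\<in>St p. G p v w = G p s w"
proof -
  obtain k :: nat and e where e: "\<And>i. i < k \<Longrightarrow> e i \<in> T p" "St p = range (\<lambda>c. \<Sum>i<k. c i *\<^sub>t e i)"
    "\<forall>c. (\<Sum>i<k. c i *\<^sub>t e i) = 0 \<longrightarrow> (\<forall>i<k. c i = 0)" by (rule St_frame[of p]) blast
  have "nondegenerate_on (G p) (St p)"
    using screen_transversal unfolding screen_transversal_bundle_def by blast
  then show ?thesis
    by (intro nondegenerate_projection[OF tvec_subspace_tangent_space e(1) e(2) e(3)[THEN spec, THEN mp]
          metric_linear(1)[OF metric] metric_linear(2)[OF metric] _ v])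
qed

text \<open>Subtract from \<open>v\<close> its projections \<open>s\<close> to the screen and \<open>z\<close> to the screen transversal space,
  and then its components with respect to the null frame \<open>\<xi>\<^sub>i\<close>, \<open>N\<^sub>i\<close>. The remainder \<open>w\<close> is orthogonal to
  all of these. Being orthogonal to the radical and the screen it is normal, thus the sum of
  a radical vector, which vanishes by pairing with the \<open>N\<^sub>i\<close>, and a screen transversal one, which
  vanishes by nondegeneracy.\<close>
lemma ambient_decomposition:
  assumes v: "v \<in> T p"
  shows "\<exists>t\<in>tangent_space A p. \<exists>l\<in>ltr p. \<exists>s\<in>St p. v = push B f t + l + s"
proof -
  obtain \<xi> N where \<xi>: "\<And>i. i < r \<Longrightarrow> \<xi> i \<in> Rad A B f g p" and N: "\<And>i. i < r \<Longrightarrow> N i \<in> ltr p"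
    and NT: "\<And>i. i < r \<Longrightarrow> N i \<in> T p"
    and R: "Rad A B f g p = range (\<lambda>c. \<Sum>i<r. c i *\<^sub>t \<xi> i)"
    and L: "ltr p = range (\<lambda>c. \<Sum>i<r. c i *\<^sub>t N i)"
    and N\<xi>: "\<And>i j. i < r \<Longrightarrow> j < r \<Longrightarrow> G p (N i) (push B f (\<xi> j)) = (if i = j then 1 else 0)"
    and NN: "\<And>i j. i < r \<Longrightarrow> j < r \<Longrightarrow> G p (N i) (N j) = 0"
    by (rule null_frame[of p]) blast
  have \<xi>T: "push B f (\<xi> i) \<in> T p" if "i < r" for i using push_T Rad_tangent \<xi> that by blast
  note pushR = push_sum[where I = "{..<r}" and u = \<xi>]
  have \<xi>N: "G p (push B f (\<xi> i)) (N j) = (if i = j then 1 else 0)" if "i < r" "j < r" for i j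
    using N\<xi>[OF that(2,1)] G_sym[OF \<xi>T[OF that(1)] NT[OF that(2)]] by auto
  have delta: "(\<Sum>i<r. c i * (if i = j then 1 else 0)) = c j" if "j < r" for c :: "nat \<Rightarrow> real" and j
  proof -
    have "(\<Sum>i<r. c i * (if i = j then 1 else 0)) = (\<Sum>i<r. if i = j then c i else 0)"
      by (intro sum.cong) auto
    then show ?thesis using that by simp
  qed
  obtain s where s: "s \<in> S p" "\<And>u. u \<in> S p \<Longrightarrow> G p v (push B f u) = G p (push B f s) (push B f u)"
    using S_projection[OF v] by blast
  have sT: "push B f s \<in> T p" by (rule push_T[OF S_tangent[OF s(1)]])
  define v1 where "v1 = v - push B f s"
  have v1: "v1 \<in> T p" unfolding v1_def by (rule tangent_space_diff[OF v sT])
  obtain z where z: "z \<in> St p" "\<And>w. w \<in> St p \<Longrightarrow> G p v1 w = G p z w"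
    using St_projection[OF v1] by blast
  define v2 where "v2 = v1 - z"
  have v2: "v2 \<in> T p" unfolding v2_def by (rule tangent_space_diff[OF v1 St_T[OF z(1)]])
  have v2S: "G p v2 (push B f u) = 0" if "u \<in> S p" for u
    using G_left(2)[OF push_T[OF S_tangent[OF that]]] v1 St_T[OF z(1)] v sT s(2)[OF that]
      St_push_orthogonal[OF z(1) S_tangent[OF that]] by (simp add: v2_def v1_def)
  have v2St: "G p v2 w = 0" if "w \<in> St p" for w
    using G_left(2)[OF St_T[OF that] v1 St_T[OF z(1)]] z(2)[OF that] by (simp add: v2_def)
  define \<rho> where "\<rho> = (\<Sum>i<r. G p v2 (N i) *\<^sub>t \<xi> i)"
  define l where "l = (\<Sum>i<r. G p v2 (push B f (\<xi> i)) *\<^sub>t N i)"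
  have \<rho>: "\<rho> \<in> Rad A B f g p" unfolding \<rho>_def R by (rule rangeI)
  have l: "l \<in> ltr p" unfolding l_def L by (rule rangeI)
  have \<rho>t: "\<rho> \<in> tangent_space A p" by (rule Rad_tangent[OF \<rho>])
  have \<rho>T: "push B f \<rho> \<in> T p" by (rule push_T[OF \<rho>t])
  have lT: "l \<in> T p" by (rule ltr_T[OF l])
  define w where "w = v2 - (push B f \<rho> + l)"
  have w: "w \<in> T p" unfolding w_def by (intro tangent_space_diff tangent_space_plus v2 \<rho>T lT)
  have Gw: "G p w x = G p v2 x - (G p (push B f \<rho>) x + G p l x)" if "x \<in> T p" for x
    unfolding w_def
    using G_left(2)[OF that v2 tangent_space_plus[OF \<rho>T lT]] G_left(1)[OF that \<rho>T lT] by simp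
  have wN: "G p w (N j) = 0" if j: "j < r" for j
  proof -
    have "G p (push B f \<rho>) (N j) = G p v2 (N j)"
      unfolding \<rho>_def pushR
      using G_left_sum[OF NT[OF j], of "{..<r}" "\<lambda>i. push B f (\<xi> i)"] \<xi>T \<xi>N[OF _ j] delta[OF j] by simp
    moreover have "G p l (N j) = 0"
      unfolding l_def using G_left_sum[OF NT[OF j], of "{..<r}" N] NT NN[OF _ j] by simp
    ultimately show ?thesis using Gw[OF NT[OF j]] by simp
  qed
  have w\<xi>: "G p w (push B f (\<xi> j)) = 0" if j: "j < r" for j
  proof -
    have "G p l (push B f (\<xi> j)) = G p v2 (push B f (\<xi> j))"
      unfolding l_def using G_left_sum[OF \<xi>T[OF j], of "{..<r}" N] NT N\<xi>[OF _ j] delta[OF j] by simp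
    then show ?thesis
      using Gw[OF \<xi>T[OF j]] Rad_push_orthogonal[OF \<rho> Rad_tangent[OF \<xi>[OF j]]] by simp
  qed
  have wS: "G p w (push B f u) = 0" if "u \<in> S p" for u
    using Gw[OF push_T[OF S_tangent[OF that]]] v2S[OF that]
      Rad_push_orthogonal[OF \<rho> S_tangent[OF that]] ltr_S_orthogonal[OF l that] by simp
  have wSt: "G p w x = 0" if "x \<in> St p" for x
    using Gw[OF St_T[OF that]] v2St[OF that] G_sym[OF \<rho>T St_T[OF that]]
      St_push_orthogonal[OF that \<rho>t] ltr_St_orthogonal[OF l that] by simp
  have "w \<in> normal_space A B f g p"
    unfolding normal_space_def
  proof (intro CollectI conjI w ballI)
    fix u assume "u \<in> tangent_space A p"
    then obtain a b where u: "a \<in> Rad A B f g p" "b \<in> S p" "u = a + b" using tangent_split(1)[of u p] by blast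
    obtain c where "a = (\<Sum>i<r. c i *\<^sub>t \<xi> i)" using u(1) R by blast
    then have "G p w (push B f a) = (\<Sum>i<r. c i * G p w (push B f (\<xi> i)))"
      using G_linear(5)[OF w, of "{..<r}" "\<lambda>i. push B f (\<xi> i)" c] \<xi>T by (simp add: pushR)
    then have "G p w (push B f a) = 0" using w\<xi> by simp
    then show "G p w (push B f u) = 0"
      using G_linear(1)[OF w push_T[OF Rad_tangent[OF u(1)]] push_T[OF S_tangent[OF u(2)]]] wS[OF u(2)]
      by (simp add: u(3) push_plus)
  qed
  then obtain a x where a: "a \<in> Rad A B f g p" and x: "x \<in> St p" and wax: "w = push B f a + x"
    using normal_split[of w p] by blast
  have aT: "push B f a \<in> T p" using push_T[OF Rad_tangent[OF a]] .
  have "x = 0"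
  proof -
    have "G p x y = 0" if y: "y \<in> St p" for y
      using wSt[OF y] G_left(1)[OF St_T[OF y] aT St_T[OF x]] G_sym[OF aT St_T[OF y]]
        St_push_orthogonal[OF y Rad_tangent[OF a]] by (simp add: wax)
    then show ?thesis
      using screen_transversal x unfolding screen_transversal_bundle_def nondegenerate_on_def by blast
  qed
  moreover obtain c where c: "a = (\<Sum>i<r. c i *\<^sub>t \<xi> i)" using a R by blast
  moreover have "c j = 0" if j: "j < r" for j
  proof -
    have "G p (push B f a) (N j) = c j"
      unfolding c pushR
      using G_left_sum[OF NT[OF j], of "{..<r}" "\<lambda>i. push B f (\<xi> i)" c] \<xi>T \<xi>N[OF _ j] delta[OF j] by simp
    then show ?thesis using wN[OF j] \<open>x = 0\<close> by (simp add: wax)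
  qed
  ultimately have "push B f a = 0" by (simp only: pushR) (intro sum.neutral ballI, simp)
  then have "w = 0" using \<open>x = 0\<close> by (simp add: wax)
  then have "v2 = push B f \<rho> + l" by (simp add: w_def)
  then have "v = push B f (s + \<rho>) + l + z"
    unfolding v2_def v1_def push_plus by (simp add: algebra_simps)
  moreover have "s + \<rho> \<in> tangent_space A p" by (rule tangent_space_plus[OF S_tangent[OF s(1)] \<rho>t])
  ultimately show ?thesis using l z(1) by blast
qed

text \<open>Pairing with the radical detects \<open>l\<close>, since \<open>t\<close> and \<open>s\<close> are orthogonal to it; then pairing with
  the screen transversal space detects \<open>s\<close>.\<close>
lemma ambient_decomposition_unique:
  assumes t: "t \<in> tangent_space A p" and l: "l \<in> ltr p" and s: "s \<in> St p"
    and 0: "push B f t + l + s = 0"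
  shows "t = 0"
proof -
  obtain \<xi> N where \<xi>: "\<And>i. i < r \<Longrightarrow> \<xi> i \<in> Rad A B f g p"
    and NT: "\<And>i. i < r \<Longrightarrow> N i \<in> T p"
    and L: "ltr p = range (\<lambda>c. \<Sum>i<r. c i *\<^sub>t N i)"
    and N\<xi>: "\<And>i j. i < r \<Longrightarrow> j < r \<Longrightarrow> G p (N i) (push B f (\<xi> j)) = (if i = j then 1 else 0)"
    by (rule null_frame[of p]) blast
  have tT: "push B f t \<in> T p" and lT: "l \<in> T p" and sT: "s \<in> T p"
    using push_T[OF t] ltr_T[OF l] St_T[OF s] .
  have G0: "G p (push B f t) x + G p l x + G p s x = 0" if "x \<in> T p" for x
    using G_left(1)[OF that tangent_space_plus[OF tT lT] sT] G_left(1)[OF that tT lT]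
      G_left(3)[OF that tangent_space_zero, of 0] by (simp add: 0)
  obtain c where c: "l = (\<Sum>i<r. c i *\<^sub>t N i)" using l L by blast
  have "c j = 0" if j: "j < r" for j
  proof -
    have \<xi>t: "\<xi> j \<in> tangent_space A p" by (rule Rad_tangent[OF \<xi>[OF j]])
    have "G p l (push B f (\<xi> j)) = (\<Sum>i<r. c i * G p (N i) (push B f (\<xi> j)))"
      unfolding c using NT by (intro G_left_sum push_T \<xi>t) auto
    also have "\<dots> = (\<Sum>i<r. if i = j then c i else 0)" using N\<xi> j by (intro sum.cong) auto
    finally have "G p l (push B f (\<xi> j)) = c j" using j by simp
    moreover have "G p (push B f t) (push B f (\<xi> j)) = 0"
      using G_sym[OF tT push_T[OF \<xi>t]] Rad_push_orthogonal[OF \<xi>[OF j] t] by simp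
    ultimately show ?thesis using G0[OF push_T[OF \<xi>t]] St_push_orthogonal[OF s \<xi>t] by simp
  qed
  then have "l = 0" unfolding c by simp
  have "G p s y = 0" if y: "y \<in> St p" for y
    using G0[OF St_T[OF y]] G_sym[OF tT St_T[OF y]] St_push_orthogonal[OF y t]
      ltr_St_orthogonal[OF l y] by simp
  then have "s = 0"
    using screen_transversal s unfolding screen_transversal_bundle_def nondegenerate_on_def by blast
  then show ?thesis using 0 \<open>l = 0\<close> push_eq_0_iff[OF t] by simp
qed

lemma St_subspace: "tvec_subspace (St p)"
  by (rule St_frame[of p]) (simp only: tvec_subspace_range)

lemma ltr_subspace: "tvec_subspace (ltr p)"
  by (rule null_frame[of p]) (simp only: tvec_subspace_range)

lemma S_subspace: "tvec_subspace (S p)"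
  by (rule S_frame[of p]) (simp only: tvec_subspace_range)

lemma Rad_subspace: "tvec_subspace (Rad A B f g p)"
  by (rule null_frame[of p]) (simp only: tvec_subspace_range)

lemma tangential_part:
  assumes v: "v \<in> T p"
  defines "t \<equiv> tangential_part A B f St ltr p v"
  shows "t \<in> tangent_space A p" "\<exists>l\<in>ltr p. \<exists>s\<in>St p. v = push B f t + l + s"
proof -
  let ?P = "\<lambda>t. t \<in> tangent_space A p \<and> (\<exists>l\<in>ltr p. \<exists>s\<in>St p. v = push B f t + l + s)"
  have "\<exists>!t. ?P t"
  proof (rule ex_ex1I)
    show "\<exists>t. ?P t" using ambient_decomposition[OF v] by blast
    fix t t' assume "?P t" "?P t'"
    then obtain l s l' s' where t: "t \<in> tangent_space A p" "t' \<in> tangent_space A p"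
      and ls: "l \<in> ltr p" "l' \<in> ltr p" "s \<in> St p" "s' \<in> St p"
      and eq: "v = push B f t + l + s" "v = push B f t' + l' + s'" by blast
    have "push B f (t - t') + (l - l') + (s - s') = 0"
      using eq unfolding push_diff by (simp add: algebra_simps)
    then have "t - t' = 0"
      by (intro ambient_decomposition_unique[OF tangent_space_diff[OF t]
            tvec_subspaceD(3)[OF ltr_subspace ls(1,2)] tvec_subspaceD(3)[OF St_subspace ls(3,4)]])
    then show "t = t'" by simp
  qed
  from theI'[OF this] show "t \<in> tangent_space A p" "\<exists>l\<in>ltr p. \<exists>s\<in>St p. v = push B f t + l + s"
    unfolding t_def tangential_part_def by blast+
qed

text \<open>The radical part of \<open>t\<close> pairs to zero with the screen, and the screen is nondegenerate.\<close>
lemma Rad_iff_screen_orthogonal: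
  assumes t: "t \<in> tangent_space A p"
  shows "t \<in> Rad A B f g p \<longleftrightarrow> (\<forall>u\<in>S p. G p (push B f t) (push B f u) = 0)"
proof
  assume "t \<in> Rad A B f g p"
  then show "\<forall>u\<in>S p. G p (push B f t) (push B f u) = 0"
    using Rad_push_orthogonal S_tangent by blast
next
  assume o: "\<forall>u\<in>S p. G p (push B f t) (push B f u) = 0"
  obtain w s where ws: "w \<in> Rad A B f g p" "s \<in> S p" "t = w + s" using tangent_split(1)[of t p] t by blast
  have "G p (push B f s) (push B f u) = 0" if u: "u \<in> S p" for u
    using o u Rad_push_orthogonal[OF ws(1) S_tangent[OF u]]
      G_left(1)[OF push_T[OF S_tangent[OF u]] push_T[OF Rad_tangent[OF ws(1)]] push_T[OF S_tangent[OF ws(2)]]]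
    by (simp add: ws(3) push_plus)
  then have "push B f s = 0"
    using screen ws(2) unfolding screen_distribution_def nondegenerate_on_def by blast
  then show "t \<in> Rad A B f g p" using push_eq_0_iff[OF S_tangent[OF ws(2)]] ws by simp
qed

text \<open>Both transversal bundles are orthogonal to the screen, so the tangential part may be replaced by
  \<open>v\<close> itself in the previous criterion.\<close>
lemma tangential_part_Rad_iff:
  assumes v: "v \<in> T p"
  shows "tangential_part A B f St ltr p v \<in> Rad A B f g p \<longleftrightarrow> (\<forall>u\<in>S p. G p v (push B f u) = 0)"
proof -
  let ?t = "tangential_part A B f St ltr p v"
  note t = tangential_part[OF v]
  obtain l s where ls: "l \<in> ltr p" "s \<in> St p" and eq: "v = push B f ?t + l + s" using t(2) by blast
  have "G p v (push B f u) = G p (push B f ?t) (push B f u)" if u: "u \<in> S p" for u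
  proof -
    note uT = push_T[OF S_tangent[OF u]]
    have "G p (push B f ?t + l + s) (push B f u) = G p (push B f ?t) (push B f u)"
      using G_left(1)[OF uT tangent_space_plus[OF push_T[OF t(1)] ltr_T[OF ls(1)]] St_T[OF ls(2)]]
        G_left(1)[OF uT push_T[OF t(1)] ltr_T[OF ls(1)]] ltr_S_orthogonal[OF ls(1) u]
        St_push_orthogonal[OF ls(2) S_tangent[OF u]] by simp
    then show ?thesis using eq by simp
  qed
  then show ?thesis using Rad_iff_screen_orthogonal[OF t(1)] by simp
qed

lemma screen_part_eq_0_iff:
  assumes t: "t \<in> tangent_space A p"
  shows "screen_part A B f g S p t = 0 \<longleftrightarrow> t \<in> Rad A B f g p"
proof -
  let ?P = "\<lambda>s. s \<in> S p \<and> (\<exists>w\<in>Rad A B f g p. t = w + s)"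
  have uniq: "\<exists>!s. ?P s"
  proof (rule ex_ex1I)
    show "\<exists>s. ?P s" using tangent_split(1)[of t p] t by blast
    fix s s' assume "?P s" "?P s'"
    then obtain w w' where ws: "w \<in> Rad A B f g p" "w' \<in> Rad A B f g p" "s \<in> S p" "s' \<in> S p"
      and eq: "t = w + s" "t = w' + s'" by blast
    have "s - s' = w' - w" using eq by (simp add: algebra_simps)
    then have "s - s' \<in> Rad A B f g p \<inter> S p"
      using tvec_subspaceD(3)[OF Rad_subspace ws(2,1)] tvec_subspaceD(3)[OF S_subspace ws(3,4)] by simp
    then show "s = s'" using tangent_split(2) by auto
  qed
  have "screen_part A B f g S p t = 0 \<longleftrightarrow> ?P 0"
    unfolding screen_part_def using theI'[OF uniq] the1_equality[OF uniq, of 0] by auto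
  also have "\<dots> \<longleftrightarrow> t \<in> Rad A B f g p" using tangent_split(2)[of p] by auto
  finally show ?thesis .
qed

end

section \<open>Totally geodesic radical distributions\<close>

theorem theorem4p4:
  fixes A :: "('n::{t2_space, second_countable_topology}, 'd::euclidean_space) atlas"
    and B :: "('m::{t2_space, second_countable_topology}, 'e::euclidean_space) atlas"
    and f :: "'n \<Rightarrow> 'm"
    and g :: "'m metric"
    and P :: "'m \<Rightarrow> 'm tvec \<Rightarrow> 'm tvec"
    and nab :: "('m \<Rightarrow> 'm tvec) \<Rightarrow> ('m \<Rightarrow> 'm tvec) \<Rightarrow> 'm \<Rightarrow> 'm tvec"
    and D :: "('n \<Rightarrow> 'n tvec) \<Rightarrow> ('n \<Rightarrow> 'm tvec) \<Rightarrow> 'n \<Rightarrow> 'm tvec"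
    and S :: "'n \<Rightarrow> 'n tvec set"
    and St ltr :: "'n \<Rightarrow> 'm tvec set"
    and r :: nat
  assumes golden: "golden_semi_riemannian B g nab P"
    and lightlike: "lightlike_submanifold A B f g r"
    and screen: "screen_distribution A B f g S"
    and screen_transversal: "screen_transversal_bundle A B f g St"
    and lightlike_transversal: "lightlike_transversal_bundle A B f g r S St ltr"
    and D: "induced_connection_along A B f nab D"
    and radical: "radical_screen_transversal A B f g P S St"
  shows "totally_geodesic_foliation A (induced_conn A B f D St ltr) (Rad A B f g) \<longleftrightarrow>
    (\<forall>W\<in>distr_sections A (Rad A B f g). \<forall>U\<in>distr_sections A (Rad A B f g).
       (\<forall>p. screen_part A B f g S p
          (shape_op A B f D St ltr (\<lambda>x. P (f x) (push B f (U x))) W p) = 0) \<and>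
       (\<forall>p. screen_shape_op A B f g D S St ltr U W p = 0))"
proof -
  have manifold_B: "smooth_manifold B" and metric: "semi_riemannian_metric B g"
    using golden unfolding golden_semi_riemannian_def by blast+
  interpret lightlike_submanifold_with_bundles A B f g r S St ltr
    by unfold_locales fact+
  have P: "endomorphism_field B P"
    using golden unfolding golden_semi_riemannian_def endomorphism_field_def by blast
  have P_sym: "g q (P q u) v = g q u (P q v)"
    if "u \<in> tangent_space B q" "v \<in> tangent_space B q" for q u v
    using golden that unfolding golden_semi_riemannian_def by blast
  have parallel: "nab X (\<lambda>q. P q (Y q)) = (\<lambda>q. P q (nab X Y q))"
    if "X \<in> vector_fields B" "Y \<in> vector_fields B" for X Y
    using golden that unfolding golden_semi_riemannian_def by blast
  have PS: "P (f p) ` push B f ` S p = push B f ` S p" for p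
    using radical unfolding radical_screen_transversal_def by blast
  \<comment> \<open>Each of the two conditions is pointwise equivalent to the totally geodesic condition.\<close>
  have *: "(induced_conn A B f D St ltr W U p \<in> Rad A B f g p \<longleftrightarrow>
      screen_shape_op A B f g D S St ltr U W p = 0) \<and>
    (induced_conn A B f D St ltr W U p \<in> Rad A B f g p \<longleftrightarrow>
      screen_part A B f g S p (shape_op A B f D St ltr (\<lambda>x. P (f x) (push B f (U x))) W p) = 0)"
    if W: "W \<in> vector_fields A" and U: "U \<in> vector_fields A" for W U p
  proof -
    let ?v = "D W (\<lambda>x. push B f (U x)) p" and ?v' = "D W (\<lambda>x. P (f x) (push B f (U x))) p"
    have V: "(\<lambda>x. push B f (U x)) \<in> fields_along A B f" by (rule fields_along_push[OF manifold_A manifold_B smooth_f U])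
    then have "D W (\<lambda>x. push B f (U x)) \<in> fields_along A B f"
      using D W smooth_funs_const[of 0 A]
      unfolding induced_connection_along_def connection_along_def by blast
    then have v: "?v \<in> T p" by (simp add: fields_along_iff)
    have v': "?v' = P (f p) ?v"
      by (rule connection_along_parallel_endomorphism[OF manifold_A manifold_B smooth_f P parallel D W V])
    have v'T: "?v' \<in> T p" unfolding v' by (rule endomorphism_fieldD(1)[OF P v v])
    have 1: "induced_conn A B f D St ltr W U p \<in> Rad A B f g p \<longleftrightarrow>
        screen_shape_op A B f g D S St ltr U W p = 0"
      using screen_part_eq_0_iff[OF tangential_part(1)[OF v]]
      by (simp add: screen_shape_op_def induced_conn_def)
    have "screen_part A B f g S p (- tangential_part A B f St ltr p ?v') = 0 \<longleftrightarrow>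
        - tangential_part A B f St ltr p ?v' \<in> Rad A B f g p"
      by (intro screen_part_eq_0_iff tangent_space_uminus tangential_part(1)[OF v'T])
    also have "\<dots> \<longleftrightarrow> tangential_part A B f St ltr p ?v' \<in> Rad A B f g p"
      using tvec_subspaceD(4)[OF Rad_subspace, of "tangential_part A B f St ltr p ?v'" p]
        tvec_subspaceD(4)[OF Rad_subspace, of "- tangential_part A B f St ltr p ?v'" p] by auto
    also have "\<dots> \<longleftrightarrow> (\<forall>u\<in>S p. G p (P (f p) ?v) (push B f u) = 0)"
      using tangential_part_Rad_iff[OF v'T] by (simp only: v')
    also have "\<dots> \<longleftrightarrow> (\<forall>u\<in>S p. G p ?v (P (f p) (push B f u)) = 0)"
      using P_sym[OF v push_T[OF S_tangent]] by simp
    also have "\<dots> \<longleftrightarrow> (\<forall>x\<in>P (f p) ` push B f ` S p. G p ?v x = 0)" by blast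
    also have "\<dots> \<longleftrightarrow> (\<forall>u\<in>S p. G p ?v (push B f u) = 0)" unfolding PS by blast
    also have "\<dots> \<longleftrightarrow> induced_conn A B f D St ltr W U p \<in> Rad A B f g p"
      unfolding induced_conn_def by (rule tangential_part_Rad_iff[OF v, symmetric])
    finally show ?thesis using 1 by (simp add: shape_op_def)
  qed
  then show ?thesis
    unfolding totally_geodesic_foliation_def distr_sections_def by blast
qed

end
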